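(* Let $n\ge 2$. The metric space $(B_T^n,d)$ is $\ln(3)$-hyperbolic, and this value of $\delta$ is optimal; that is, $\delta=\ln(3)$ is the smallest $\delta\ge 0$ for which $(B_T^n,d)$ is $\delta$-hyperbolic.
   Context: For $v \in \mathbb{R}^n$ let $\|v\|_T = \sum_{i=1}^n |v_i|$, and let $B_T^n = \{x \in \mathbb{R}^n : \|x\|_T < 1\}$. $\Gamma(p,q)$ is the set of maps $\gamma : [0,1] \to B_T^n$ all of whose components are absolutely continuous, with $\gamma(0)=p$ and $\gamma(1)=q$. The length of such a curve is $\mathcal{L}(\gamma) = \int_0^1 \frac{\|\gamma'(t)\|_T}{1-\|\gamma(t)\|_T^2}\,dt$, and $d(p,q) = \inf_{\gamma\in\Gamma(p,q)} \mathcal{L}(\gamma)$. The Gromov product of $x$ and $y$ with base point $z$ is $G(x,y;z) = \frac12\left[d(x,z)+d(y,z)-d(x,y)\right]$. For $\delta\ge 0$, a metric space is $\delta$-hyperbolic if for all points $x,y,z,w$ one has $G(x,y;w) \ge \min\{G(x,z;w), G(y,z;w)\} - \delta$. *)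

theory Defs
  imports "HOL-Analysis.Analysis"
begin

definition taxicab_norm :: "real ^ 'n \<Rightarrow> real" where
  "taxicab_norm v = (\<Sum>i\<in>UNIV. \<bar>v $ i\<bar>)"

definition taxicab_ball :: "(real ^ 'n) set" where
  "taxicab_ball = {x. taxicab_norm x < 1}"

(* The usual epsilon-delta condition; D is a finite family of subintervals (u,v) of [a,b]
   with pairwise disjoint interiors, given by their endpoints. *)
definition abs_continuous_on_interval :: "real \<Rightarrow> real \<Rightarrow> (real \<Rightarrow> real) \<Rightarrow> bool" where
  "abs_continuous_on_interval a b f \<longleftrightarrow>
     (\<forall>\<epsilon>>0. \<exists>\<delta>>0. \<forall>D::(real \<times> real) set.
        finite D \<longrightarrow>
        (\<forall>(u, v)\<in>D. a \<le> u \<and> u \<le> v \<and> v \<le> b) \<longrightarrow>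
        disjoint_family_on (\<lambda>(u, v). {u<..<v}) D \<longrightarrow>
        (\<Sum>(u, v)\<in>D. v - u) < \<delta> \<longrightarrow>
        (\<Sum>(u, v)\<in>D. \<bar>f v - f u\<bar>) < \<epsilon>)"

(* A curve is a total function of which only the restriction to [0,1] matters: no condition
   here, nor its length below, depends on its values elsewhere. *)
definition taxicab_curves :: "real ^ 'n \<Rightarrow> real ^ 'n \<Rightarrow> (real \<Rightarrow> real ^ 'n) set" where
  "taxicab_curves p q =
     {\<gamma>. \<gamma> ` {0..1} \<subseteq> taxicab_ball \<and>
         (\<forall>i. abs_continuous_on_interval 0 1 (\<lambda>t. \<gamma> t $ i)) \<and>
         \<gamma> 0 = p \<and> \<gamma> 1 = q}"

(* For a curve in taxicab_curves the derivative exists almost everywhere and the integrand is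
   Lebesgue integrable, so neither the arbitrary value of vector_derivative at the remaining
   points nor the default value of the integral plays a role. *)
definition taxicab_length :: "(real \<Rightarrow> real ^ 'n) \<Rightarrow> real" where
  "taxicab_length \<gamma> =
     (LINT t:{0..1}|lebesgue.
        taxicab_norm (vector_derivative \<gamma> (at t within {0..1})) / (1 - (taxicab_norm (\<gamma> t))\<^sup>2))"

(* The value 0 outside the ball, where there are no curves, is irrelevant; it is there because
   the library's Metric_space requires nonnegativity on the whole type. *)
definition taxicab_dist :: "real ^ 'n \<Rightarrow> real ^ 'n \<Rightarrow> real" where
  "taxicab_dist p q =
     (if p \<in> taxicab_ball \<and> q \<in> taxicab_ball
      then INF \<gamma>\<in>taxicab_curves p q. taxicab_length \<gamma> else 0)"

definition gromov_product :: "('a \<Rightarrow> 'a \<Rightarrow> real) \<Rightarrow> 'a \<Rightarrow> 'a \<Rightarrow> 'a \<Rightarrow> real" where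
  "gromov_product d x y z = (1 / 2) * (d x z + d y z - d x y)"

definition gromov_hyperbolic :: "real \<Rightarrow> 'a set \<Rightarrow> ('a \<Rightarrow> 'a \<Rightarrow> real) \<Rightarrow> bool" where
  "gromov_hyperbolic \<delta> M d \<longleftrightarrow>
     0 \<le> \<delta> \<and> Metric_space M d \<and>
     (\<forall>x\<in>M. \<forall>y\<in>M. \<forall>z\<in>M. \<forall>w\<in>M.
        gromov_product d x y w \<ge> min (gromov_product d x z w) (gromov_product d y z w) - \<delta>)"

end

theory Submission
  imports Defs
begin

text \<open>
  Write \<open>p \<and> q\<close> for the vector that keeps in each coordinate the common part of \<open>p\<close> and \<open>q\<close>: the one of
  smaller modulus if the signs agree, and 0 otherwise. Then
  \<open>d(p, q) = artanh \<parallel>p\<parallel> + artanh \<parallel>q\<parallel> - 2 artanh \<parallel>p \<and> q\<parallel>\<close>, so that \<open>artanh \<parallel>p \<and> q\<parallel>\<close> is the Gromov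
  product based at the origin. The path running straight from \<open>p\<close> to \<open>p \<and> q\<close> and then to \<open>q\<close> has this
  length. Conversely, the right-hand side satisfies the triangle inequality, because \<open>artanh\<close> is convex and
  \<open>\<parallel>x \<and> z\<parallel> + \<parallel>y \<and> z\<parallel> \<le> \<parallel>z\<parallel> + \<parallel>x \<and> y\<parallel>\<close>, and it is at most \<open>\<parallel>p - q\<parallel> / (1 - r\<^sup>2)\<close> on the ball of radius
  \<open>r\<close>; summing over fine partitions bounds the length of every curve from below. For the latter an absolutely
  continuous function must be the integral of its almost everywhere derivative, which follows from the
  Radon-Nikodym theorem (applied to the Stieltjes measure of the variation) and Vitali's covering theorem.

  In the four point condition the terms \<open>artanh \<parallel>x\<parallel>\<close> cancel, and it compares
  \<open>artanh \<parallel>x \<and> y\<parallel> + artanh \<parallel>z \<and> w\<parallel>\<close> with the two other pairings. If, say, \<open>\<parallel>y \<and> z\<parallel>\<close> is the largest of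
  the four mixed norms, then \<open>2 \<parallel>x \<and> z\<parallel> \<le> 1 + \<parallel>x \<and> y\<parallel>\<close> and \<open>2 \<parallel>y \<and> w\<parallel> \<le> 1 + \<parallel>z \<and> w\<parallel>\<close>, and
  \<open>artanh ((1 + t) / 2) \<le> artanh t + ln 3 / 2\<close> gives the constant. The points \<open>(\<plusminus>a, \<plusminus>a)\<close> with \<open>a\<close> tending
  to \<open>1/2\<close> show that it is optimal.
\<close>

section \<open>Absolutely continuous functions as indefinite integrals\<close>

lemma abs_continuous_on_intervalE:
  assumes "abs_continuous_on_interval a b f" "\<epsilon> > 0"
  obtains \<delta> where "\<delta> > 0"
    "\<And>D. \<lbrakk>finite D; \<forall>(u, v)\<in>D. a \<le> u \<and> u \<le> v \<and> v \<le> b;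
        disjoint_family_on (\<lambda>(u, v). {u<..<v}) D; (\<Sum>(u, v)\<in>D. v - u) < \<delta>\<rbrakk>
        \<Longrightarrow> (\<Sum>(u, v)\<in>D. \<bar>f v - f u\<bar>) < \<epsilon>"
proof -
  have "\<exists>\<delta>>0. \<forall>D. finite D \<longrightarrow> (\<forall>(u, v)\<in>D. a \<le> u \<and> u \<le> v \<and> v \<le> b) \<longrightarrow>
      disjoint_family_on (\<lambda>(u, v). {u<..<v}) D \<longrightarrow> (\<Sum>(u, v)\<in>D. v - u) < \<delta> \<longrightarrow>
      (\<Sum>(u, v)\<in>D. \<bar>f v - f u\<bar>) < \<epsilon>"
    using assms unfolding abs_continuous_on_interval_def by (elim allE impE)
  then show thesis
    using that by (elim exE conjE) (simp only: simp_thms)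
qed

text \<open>A set of pairs cannot hold the same interval twice, an indexed family can. Two indices
  with the same pair carry disjoint copies of one open interval, which is then empty, so the terms
  lost in passing to the set of pairs are 0.\<close>

lemma abs_continuous_on_interval_indexed:
  fixes f :: "real \<Rightarrow> real"
  assumes "abs_continuous_on_interval a b f" "\<epsilon> > 0"
  obtains \<delta> where "\<delta> > 0"
    "\<And>(I :: 'i set) u v. \<lbrakk>finite I; \<And>i. i \<in> I \<Longrightarrow> a \<le> u i \<and> u i \<le> v i \<and> v i \<le> b;
        disjoint_family_on (\<lambda>i. {u i<..<v i}) I; (\<Sum>i\<in>I. v i - u i) < \<delta>\<rbrakk>
      \<Longrightarrow> (\<Sum>i\<in>I. \<bar>f (v i) - f (u i)\<bar>) < \<epsilon>"
proof -
  obtain \<delta> where \<delta>: "\<delta> > 0" and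
    D: "\<And>D. \<lbrakk>finite D; \<forall>(u, v)\<in>D. a \<le> u \<and> u \<le> v \<and> v \<le> b;
        disjoint_family_on (\<lambda>(u, v). {u<..<v}) D; (\<Sum>(u, v)\<in>D. v - u) < \<delta>\<rbrakk>
        \<Longrightarrow> (\<Sum>(u, v)\<in>D. \<bar>f v - f u\<bar>) < \<epsilon>"
    by (rule abs_continuous_on_intervalE[OF assms]) (rule that)
  show thesis
  proof
    fix I :: "'i set" and u v :: "'i \<Rightarrow> real"
    assume I: "finite I" and uv: "\<And>i. i \<in> I \<Longrightarrow> a \<le> u i \<and> u i \<le> v i \<and> v i \<le> b"
      and dj: "disjoint_family_on (\<lambda>i. {u i<..<v i}) I" and less: "(\<Sum>i\<in>I. v i - u i) < \<delta>"
    let ?h = "\<lambda>i. (u i, v i)"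
    have eq: "v i = u i" if "i \<in> I" "j \<in> I" "i \<noteq> j" "?h i = ?h j" for i j
    proof -
      have "{u i<..<v i} \<inter> {u j<..<v j} = {}"
        using disjoint_family_onD[OF dj that(1-3)] .
      then show ?thesis using that uv[of i] by (auto simp: less_le)
    qed
    have sums: "sum g (?h ` I) = (\<Sum>i\<in>I. g (u i, v i))" if "\<And>x. g (x, x) = 0" for g :: "real \<times> real \<Rightarrow> real"
    proof (subst sum.reindex_nontrivial[OF I])
      fix i j assume "i \<in> I" "j \<in> I" "i \<noteq> j" "?h i = ?h j"
      from eq[OF this] show "g (?h i) = 0" by (simp only: that)
    qed (simp add: o_def)
    have eq2: "(\<Sum>(u, v)\<in>?h ` I. v - u) = (\<Sum>i\<in>I. v i - u i)"
      "(\<Sum>(u, v)\<in>?h ` I. \<bar>f v - f u\<bar>) = (\<Sum>i\<in>I. \<bar>f (v i) - f (u i)\<bar>)"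
      using sums[of "\<lambda>(u, v). v - u"] sums[of "\<lambda>(u, v). \<bar>f v - f u\<bar>"] by simp_all
    have "(\<Sum>(u, v)\<in>?h ` I. \<bar>f v - f u\<bar>) < \<epsilon>"
    proof (rule D)
      show "disjoint_family_on (\<lambda>(u, v). {u<..<v}) (?h ` I)"
        using dj by (fastforce simp: disjoint_family_on_def)
      show "(\<Sum>(u, v)\<in>?h ` I. v - u) < \<delta>"
        using less by (simp only: eq2)
    qed (use I uv in auto)
    then show "(\<Sum>i\<in>I. \<bar>f (v i) - f (u i)\<bar>) < \<epsilon>"
      by (simp only: eq2)
  qed (fact \<delta>)
qed

lemma abs_continuous_on_interval_diff:
  assumes f: "abs_continuous_on_interval a b f" and g: "abs_continuous_on_interval a b g"
  shows "abs_continuous_on_interval a b (\<lambda>x. f x - g x)"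
  unfolding abs_continuous_on_interval_def
proof (intro allI impI)
  fix \<epsilon> :: real assume "\<epsilon> > 0"
  then have e2: "\<epsilon> / 2 > 0" by simp
  obtain d1 where d1: "d1 > 0"
    "\<And>D. \<lbrakk>finite D; \<forall>(u, v)\<in>D. a \<le> u \<and> u \<le> v \<and> v \<le> b;
        disjoint_family_on (\<lambda>(u, v). {u<..<v}) D; (\<Sum>(u, v)\<in>D. v - u) < d1\<rbrakk>
        \<Longrightarrow> (\<Sum>(u, v)\<in>D. \<bar>f v - f u\<bar>) < \<epsilon> / 2"
    by (rule abs_continuous_on_intervalE[OF f e2]) (rule that)
  obtain d2 where d2: "d2 > 0"
    "\<And>D. \<lbrakk>finite D; \<forall>(u, v)\<in>D. a \<le> u \<and> u \<le> v \<and> v \<le> b;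
        disjoint_family_on (\<lambda>(u, v). {u<..<v}) D; (\<Sum>(u, v)\<in>D. v - u) < d2\<rbrakk>
        \<Longrightarrow> (\<Sum>(u, v)\<in>D. \<bar>g v - g u\<bar>) < \<epsilon> / 2"
    by (rule abs_continuous_on_intervalE[OF g e2]) (rule that)
  have "(\<Sum>(u, v)\<in>D. \<bar>(f v - g v) - (f u - g u)\<bar>) < \<epsilon>"
    if "finite D" "\<forall>(u, v)\<in>D. a \<le> u \<and> u \<le> v \<and> v \<le> b"
      "disjoint_family_on (\<lambda>(u, v). {u<..<v}) D" "(\<Sum>(u, v)\<in>D. v - u) < min d1 d2" for D
  proof -
    have "(\<Sum>(u, v)\<in>D. \<bar>(f v - g v) - (f u - g u)\<bar>)
        \<le> (\<Sum>(u, v)\<in>D. \<bar>f v - f u\<bar>) + (\<Sum>(u, v)\<in>D. \<bar>g v - g u\<bar>)"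
      unfolding sum.distrib[symmetric] by (intro sum_mono) auto
    then show ?thesis using d1(2)[OF that(1-3)] d2(2)[OF that(1-3)] that(4) by simp
  qed
  then show "\<exists>\<delta>>0. \<forall>D. finite D \<longrightarrow> (\<forall>(u, v)\<in>D. a \<le> u \<and> u \<le> v \<and> v \<le> b) \<longrightarrow>
      disjoint_family_on (\<lambda>(u, v). {u<..<v}) D \<longrightarrow> (\<Sum>(u, v)\<in>D. v - u) < \<delta> \<longrightarrow>
      (\<Sum>(u, v)\<in>D. \<bar>(f v - g v) - (f u - g u)\<bar>) < \<epsilon>"
    using d1(1) d2(1) by (intro exI[of _ "min d1 d2"]) auto
qed

lemma abs_continuous_on_interval_imp_continuous_on:
  assumes "abs_continuous_on_interval a b f"
  shows "continuous_on {a..b} f"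
  unfolding continuous_on_iff
proof (intro ballI allI impI)
  fix x e :: real assume x: "x \<in> {a..b}" and "e > 0"
  obtain \<delta> where \<delta>: "\<delta> > 0" and
    D: "\<And>D. \<lbrakk>finite D; \<forall>(u, v)\<in>D. a \<le> u \<and> u \<le> v \<and> v \<le> b;
        disjoint_family_on (\<lambda>(u, v). {u<..<v}) D; (\<Sum>(u, v)\<in>D. v - u) < \<delta>\<rbrakk>
        \<Longrightarrow> (\<Sum>(u, v)\<in>D. \<bar>f v - f u\<bar>) < e"
    by (rule abs_continuous_on_intervalE[OF assms \<open>e > 0\<close>]) (rule that)
  have *: "\<bar>f v - f u\<bar> < e" if "u \<in> {a..b}" "v \<in> {a..b}" "u \<le> v" "v - u < \<delta>" for u v
    using D[of "{(u, v)}"] that by (auto simp: disjoint_family_on_def)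
  have "dist (f y) (f x) < e" if "y \<in> {a..b}" "dist y x < \<delta>" for y
    using *[of x y] *[of y x] that x by (cases "x \<le> y") (auto simp: dist_real_def)
  then show "\<exists>d>0. \<forall>x'\<in>{a..b}. dist x' x < d \<longrightarrow> dist (f x') (f x) < e"
    using \<delta> by blast
qed

section \<open>Total variation\<close>

definition interval_families :: "real \<Rightarrow> real \<Rightarrow> (real \<times> real) set set" where
  "interval_families u v =
     {D. finite D \<and> (\<forall>(x, y)\<in>D. u \<le> x \<and> x \<le> y \<and> y \<le> v) \<and> disjoint_family_on (\<lambda>(x, y). {x<..<y}) D}"

definition family_variation :: "(real \<Rightarrow> real) \<Rightarrow> (real \<times> real) set \<Rightarrow> real" where
  "family_variation f D = (\<Sum>(x, y)\<in>D. \<bar>f y - f x\<bar>)"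

text \<open>The families need not fill the interval as a partition does: this is the shape that
  absolute continuity speaks of, and completing families to partitions shows that the supremum is
  the usual total variation.\<close>

definition variation :: "(real \<Rightarrow> real) \<Rightarrow> real \<Rightarrow> real \<Rightarrow> real" where
  "variation f u v = (SUP D\<in>interval_families u v. family_variation f D)"

lemma empty_in_interval_families [simp]: "{} \<in> interval_families u v"
  by (simp add: interval_families_def disjoint_family_on_def)

lemma interval_families_mono:
  "u' \<le> u \<Longrightarrow> v \<le> v' \<Longrightarrow> interval_families u v \<subseteq> interval_families u' v'"
  unfolding interval_families_def by fastforce

text \<open>Meant for clamping at a point \<open>m\<close>, with \<open>min x m\<close> or
  \<open>max x m\<close> as \<open>k x\<close>. By \<open>sub\<close>, images of disjoint open
  intervals stay disjoint; distinct pairs with the same image therefore have a degenerate one, and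
  merging them loses no variation.\<close>

lemma family_variation_image:
  assumes D: "D \<in> interval_families u v" and mono: "\<And>x y. x \<le> y \<Longrightarrow> k x \<le> k y"
    and sub: "\<And>x y. {k x<..<k y} \<subseteq> {x<..<y}"
    and rng: "\<And>x. u \<le> x \<Longrightarrow> x \<le> v \<Longrightarrow> u' \<le> k x \<and> k x \<le> v'"
  shows "(\<lambda>(x, y). (k x, k y)) ` D \<in> interval_families u' v'"
    and "family_variation f ((\<lambda>(x, y). (k x, k y)) ` D) = (\<Sum>(x, y)\<in>D. \<bar>f (k y) - f (k x)\<bar>)"
proof -
  have D': "finite D" "\<And>x y. (x, y) \<in> D \<Longrightarrow> u \<le> x \<and> x \<le> y \<and> y \<le> v"
    and dj0: "disjoint_family_on (\<lambda>(x, y). {x<..<y}) D"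
    using D by (auto simp: interval_families_def)
  have dj: "{x<..<y} \<inter> {x'<..<y'} = {}" if "(x, y) \<in> D" "(x', y') \<in> D" "(x, y) \<noteq> (x', y')"
    for x y x' y'
    using disjoint_family_onD[OF dj0 that] by simp
  show "(\<lambda>(x, y). (k x, k y)) ` D \<in> interval_families u' v'"
    unfolding interval_families_def disjoint_family_on_def
  proof (intro CollectI conjI ballI impI)
    fix d assume "d \<in> (\<lambda>(x, y). (k x, k y)) ` D"
    then obtain x y where xy: "(x, y) \<in> D" "d = (k x, k y)" by auto
    then show "case d of (x, y) \<Rightarrow> u' \<le> x \<and> x \<le> y \<and> y \<le> v'"
      using rng[of x] rng[of y] mono[of x y] D'(2)[OF xy(1)] by auto
  next
    fix d e assume "d \<in> (\<lambda>(x, y). (k x, k y)) ` D" "e \<in> (\<lambda>(x, y). (k x, k y)) ` D" "d \<noteq> e"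
    then obtain x y x' y' where xy: "(x, y) \<in> D" "d = (k x, k y)" "(x', y') \<in> D" "e = (k x', k y')"
      by auto
    with \<open>d \<noteq> e\<close> have "{x<..<y} \<inter> {x'<..<y'} = {}" by (intro dj) auto
    then have "{k x<..<k y} \<inter> {k x'<..<k y'} = {}"
      using sub[of x y] sub[of x' y'] by blast
    then show "(case d of (x, y) \<Rightarrow> {x<..<y}) \<inter> (case e of (x, y) \<Rightarrow> {x<..<y}) = {}"
      by (simp add: xy)
  qed (simp add: D'(1))
  have eq: "k y = k x" if "(x, y) \<in> D" "(x', y') \<in> D" "(x, y) \<noteq> (x', y')" "k x = k x'" "k y = k y'"
    for x y x' y'
  proof -
    have "{k x<..<k y} = {}"
      using dj[OF that(1-3)] sub[of x y] sub[of x' y'] unfolding that(4,5) by blast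
    then show ?thesis using mono[of x y] D'(2)[OF that(1)] by simp
  qed
  show "family_variation f ((\<lambda>(x, y). (k x, k y)) ` D) = (\<Sum>(x, y)\<in>D. \<bar>f (k y) - f (k x)\<bar>)"
    unfolding family_variation_def
  proof (subst sum.reindex_nontrivial[OF D'(1)])
    fix d e assume "d \<in> D" "e \<in> D" "d \<noteq> e" "(case d of (x, y) \<Rightarrow> (k x, k y)) = (case e of (x, y) \<Rightarrow> (k x, k y))"
    then show "(case case d of (x, y) \<Rightarrow> (k x, k y) of (x, y) \<Rightarrow> \<bar>f y - f x\<bar>) = 0"
      using eq[of "fst d" "snd d" "fst e" "snd e"] by (auto simp: case_prod_unfold prod_eq_iff)
  qed (simp add: o_def case_prod_unfold)
qed

text \<open>Clamp every interval at \<open>m\<close> from above and from below. The increment of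
  \<open>f\<close> across an interval is the sum of its increments across the two clamped parts, so
  the triangle inequality applies.\<close>

lemma family_variation_split:
  assumes D: "D \<in> interval_families u v" and m: "u \<le> m" "m \<le> v"
  obtains D1 D2 where "D1 \<in> interval_families u m" "D2 \<in> interval_families m v"
    "family_variation f D \<le> family_variation f D1 + family_variation f D2"
proof -
  let ?D1 = "(\<lambda>(x, y). (min x m, min y m)) ` D" and ?D2 = "(\<lambda>(x, y). (max x m, max y m)) ` D"
  have 1: "?D1 \<in> interval_families u m" "family_variation f ?D1 = (\<Sum>(x, y)\<in>D. \<bar>f (min y m) - f (min x m)\<bar>)"
    using m by (auto intro!: family_variation_image(1)[OF D, where k = "\<lambda>x. min x m"]
        family_variation_image(2)[OF D, where k = "\<lambda>x. min x m" and u' = u and v' = m])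
  have 2: "?D2 \<in> interval_families m v" "family_variation f ?D2 = (\<Sum>(x, y)\<in>D. \<bar>f (max y m) - f (max x m)\<bar>)"
    using m by (auto intro!: family_variation_image(1)[OF D, where k = "\<lambda>x. max x m"]
        family_variation_image(2)[OF D, where k = "\<lambda>x. max x m" and u' = m and v' = v])
  have "family_variation f D \<le> family_variation f ?D1 + family_variation f ?D2"
    unfolding 1(2) 2(2) unfolding family_variation_def sum.distrib[symmetric]
    by (intro sum_mono) (auto simp: min_def max_def split: prod.split)
  with 1 2 that show thesis by blast
qed

lemma sum_disjoint_interval_lengths_le:
  fixes l r :: "'i \<Rightarrow> real"
  assumes I: "finite I" "\<And>i. i \<in> I \<Longrightarrow> u \<le> l i \<and> l i \<le> r i \<and> r i \<le> v"
    and dj: "disjoint_family_on (\<lambda>i. {l i<..<r i}) I" and uv: "u \<le> v"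
  shows "(\<Sum>i\<in>I. r i - l i) \<le> v - u"
proof -
  have fm: "{l i<..<r i} \<in> fmeasurable lborel" for i
    by (cases "l i \<le> r i") (auto simp: fmeasurable_def)
  have "(\<Sum>i\<in>I. r i - l i) = (\<Sum>i\<in>I. measure lborel {l i<..<r i})"
    using I(2) by (intro sum.cong) auto
  also have "\<dots> = measure lborel (\<Union>i\<in>I. {l i<..<r i})"
    using dj fm by (intro measure_UNION'[symmetric] I) (auto simp: disjoint_family_on_def pairwise_def disjnt_def)
  also have "\<dots> \<le> measure lborel {u..v}"
    using I uv by (intro measure_mono_fmeasurable) (fastforce simp: fmeasurable_def)+
  finally show ?thesis using uv by simp
qed

context
  fixes f :: "real \<Rightarrow> real" and a b :: real
  assumes ab: "a \<le> b" and AC: "abs_continuous_on_interval a b f"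
begin

text \<open>Bisection: bounds add when adjacent intervals are joined, and by absolute continuity any
  interval shorter than \<open>\<delta>\<close> has variation at most 1.\<close>

lemma family_variation_bounded: "\<exists>B. \<forall>D\<in>interval_families a b. family_variation f D \<le> B"
proof -
  obtain \<delta> where \<delta>: "\<delta> > 0" and
    D: "\<And>D. \<lbrakk>finite D; \<forall>(u, v)\<in>D. a \<le> u \<and> u \<le> v \<and> v \<le> b;
        disjoint_family_on (\<lambda>(u, v). {u<..<v}) D; (\<Sum>(u, v)\<in>D. v - u) < \<delta>\<rbrakk>
        \<Longrightarrow> (\<Sum>(u, v)\<in>D. \<bar>f v - f u\<bar>) < 1"
    by (rule abs_continuous_on_intervalE[OF AC zero_less_one]) (rule that)
  \<comment> \<open>\<open>Bolzano\<close> also tests intervals that protrude beyond [a, b]; the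
    guards make \<open>P\<close> vacuous there.\<close>
  define P where "P = (\<lambda>u v. a \<le> u \<longrightarrow> v \<le> b \<longrightarrow> (\<exists>B. \<forall>D\<in>interval_families u v. family_variation f D \<le> B))"
  have "P a b"
  proof (rule Bolzano[OF ab])
    fix u m v assume P: "P u m" "P m v" and le: "u \<le> m" "m \<le> v"
    show "P u v" unfolding P_def
    proof (intro impI)
      assume "a \<le> u" "v \<le> b"
      then obtain B1 B2 where B: "\<forall>D\<in>interval_families u m. family_variation f D \<le> B1"
        "\<forall>D\<in>interval_families m v. family_variation f D \<le> B2"
        using P le unfolding P_def by fastforce
      have "family_variation f D \<le> B1 + B2" if "D \<in> interval_families u v" for D
        using family_variation_split[OF that le, of f] B by (metis add_mono order_trans)
      then show "\<exists>B. \<forall>D\<in>interval_families u v. family_variation f D \<le> B" by blast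
    qed
  next
    fix x
    have "P u v" if "u \<le> x \<and> x \<le> v \<and> v - u < \<delta>" for u v
      unfolding P_def
    proof (intro impI exI[of _ 1] ballI)
      fix D assume uv: "a \<le> u" "v \<le> b" and Df: "D \<in> interval_families u v"
      then have Df': "finite D" "\<forall>(x, y)\<in>D. u \<le> x \<and> x \<le> y \<and> y \<le> v"
        "disjoint_family_on (\<lambda>(x, y). {x<..<y}) D"
        by (auto simp: interval_families_def)
      have "(\<Sum>(x, y)\<in>D. y - x) \<le> v - u"
        using sum_disjoint_interval_lengths_le[of D u fst snd v] Df' that by (auto simp: case_prod_unfold)
      then have "(\<Sum>(x, y)\<in>D. y - x) < \<delta>" using that by auto
      then have "(\<Sum>(u, v)\<in>D. \<bar>f v - f u\<bar>) < 1"
        using Df'(2) uv by (intro D Df'(1,3)) auto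
      then show "family_variation f D \<le> 1" by (simp add: family_variation_def)
    qed
    then show "\<exists>d>0. \<forall>u v. u \<le> x \<and> x \<le> v \<and> v - u < d \<longrightarrow> P u v" using \<delta> by blast
  qed
  then show ?thesis by (simp add: P_def)
qed

lemma bdd_above_family_variation:
  assumes "a \<le> u" "v \<le> b"
  shows "bdd_above (family_variation f ` interval_families u v)"
  using family_variation_bounded interval_families_mono[OF assms] by (meson bdd_aboveI2 subsetD)

lemma family_variation_le_variation:
  assumes "a \<le> u" "v \<le> b" "D \<in> interval_families u v"
  shows "family_variation f D \<le> variation f u v"
  unfolding variation_def by (intro cSUP_upper assms bdd_above_family_variation)

lemma variation_le_add:
  assumes "a \<le> u" "u \<le> v" "v \<le> b"
  shows "variation f a v \<le> variation f a u + variation f u v"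
  unfolding variation_def[of f a v]
proof (rule cSUP_least)
  fix D assume "D \<in> interval_families a v"
  then obtain D1 D2 where D: "D1 \<in> interval_families a u" "D2 \<in> interval_families u v"
    "family_variation f D \<le> family_variation f D1 + family_variation f D2"
    using family_variation_split assms by metis
  with assms show "family_variation f D \<le> variation f a u + variation f u v"
    using family_variation_le_variation[of a u D1] family_variation_le_variation[of u v D2] by simp
qed (use empty_in_interval_families in blast)

text \<open>Appending the interval from \<open>u\<close> to \<open>v\<close> to a family on [a, u]
  gives a family on [a, v]. Hence both \<open>variation f a\<close> and its difference with
  \<open>f\<close> are nondecreasing, the Jordan decomposition of \<open>f\<close>.\<close>

lemma variation_increment_ge:
  assumes "a \<le> u" "u \<le> v" "v \<le> b"
  shows "\<bar>f v - f u\<bar> \<le> variation f a v - variation f a u"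
proof -
  have "variation f a u \<le> variation f a v - \<bar>f v - f u\<bar>"
    unfolding variation_def[of f a u]
  proof (rule cSUP_least)
    fix D assume D: "D \<in> interval_families a u"
    then have D': "finite D" "\<forall>(x, y)\<in>D. a \<le> x \<and> x \<le> y \<and> y \<le> u"
      "disjoint_family_on (\<lambda>(x, y). {x<..<y}) D"
      by (auto simp: interval_families_def)
    \<comment> \<open>A set absorbs a pair that it already contains, but
      \<open>(u, v) \<in> D\<close> forces \<open>v = u\<close>, and then the extra term is
      0.\<close>
    have "family_variation f D + \<bar>f v - f u\<bar> = family_variation f (insert (u, v) D)"
      using D' assms by (cases "(u, v) \<in> D") (fastforce simp: family_variation_def insert_absorb)+
    also have "insert (u, v) D \<in> interval_families a v"
    proof -
      have "{u<..<v} \<inter> {x<..<y} = {}" if "(x, y) \<in> D" for x y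
        using D'(2) that by fastforce
      then have "disjoint_family_on (\<lambda>(x, y). {x<..<y}) (insert (u, v) D)"
        using D'(3) unfolding disjoint_family_on_def by blast
      then show ?thesis
        using D'(1,2) assms unfolding interval_families_def by fastforce
    qed
    then have "family_variation f (insert (u, v) D) \<le> variation f a v"
      using assms by (intro family_variation_le_variation) auto
    finally show "family_variation f D \<le> variation f a v - \<bar>f v - f u\<bar>" by simp
  qed (use empty_in_interval_families in blast)
  then show ?thesis by simp
qed

text \<open>The variation over each interval of \<open>D\<close> is nearly attained by a family
  inside it. Together these families are nonoverlapping and no longer in total than
  \<open>D\<close>, so absolute continuity of \<open>f\<close> bounds their joint variation.\<close>

lemma abs_continuous_variation: "abs_continuous_on_interval a b (variation f a)"
  unfolding abs_continuous_on_interval_def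
proof (intro allI impI)
  fix \<epsilon> :: real assume "\<epsilon> > 0"
  then have e2: "\<epsilon> / 2 > 0" by simp
  obtain \<delta> where \<delta>: "\<delta> > 0" and
    S: "\<And>(I :: ((real \<times> real) \<times> (real \<times> real)) set) u v.
        \<lbrakk>finite I; \<And>i. i \<in> I \<Longrightarrow> a \<le> u i \<and> u i \<le> v i \<and> v i \<le> b;
        disjoint_family_on (\<lambda>i. {u i<..<v i}) I; (\<Sum>i\<in>I. v i - u i) < \<delta>\<rbrakk>
      \<Longrightarrow> (\<Sum>i\<in>I. \<bar>f (v i) - f (u i)\<bar>) < \<epsilon> / 2"
    by (rule abs_continuous_on_interval_indexed[OF AC e2, where 'i = "(real \<times> real) \<times> (real \<times> real)"]) (rule that, blast+)
  have "(\<Sum>(u, v)\<in>D. \<bar>variation f a v - variation f a u\<bar>) < \<epsilon>"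
    if D: "finite D" "\<forall>(u, v)\<in>D. a \<le> u \<and> u \<le> v \<and> v \<le> b"
      "disjoint_family_on (\<lambda>(u, v). {u<..<v}) D" "(\<Sum>(u, v)\<in>D. v - u) < \<delta>" for D
  proof -
    have D2: "a \<le> fst d" "fst d \<le> snd d" "snd d \<le> b" if "d \<in> D" for d
      using D(2) that by auto
    \<comment> \<open>The total error \<open>card D * \<eta>\<close> is at most
      \<open>\<epsilon> / 2\<close>; the added 1 keeps the denominator positive for empty
      \<open>D\<close>.\<close>
    define \<eta> where "\<eta> = \<epsilon> / (2 * (real (card D) + 1))"
    have "\<eta> > 0" using \<open>\<epsilon> > 0\<close> by (simp add: \<eta>_def)
    have "\<exists>E\<in>interval_families (fst d) (snd d). variation f (fst d) (snd d) - \<eta> < family_variation f E"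
      if "d \<in> D" for d
    proof -
      have "variation f (fst d) (snd d) - \<eta> < variation f (fst d) (snd d)" using \<open>\<eta> > 0\<close> by simp
      then show ?thesis
        unfolding variation_def
        using less_cSUP_iff[OF _ bdd_above_family_variation, of "fst d" "snd d"] D2[OF that]
          empty_in_interval_families by blast
    qed
    then obtain E where E: "\<And>d. d \<in> D \<Longrightarrow> E d \<in> interval_families (fst d) (snd d)"
      "\<And>d. d \<in> D \<Longrightarrow> variation f (fst d) (snd d) - \<eta> < family_variation f (E d)"
      by metis
    then have E': "finite (E d)" "\<forall>(x, y)\<in>E d. fst d \<le> x \<and> x \<le> y \<and> y \<le> snd d"
      "disjoint_family_on (\<lambda>(x, y). {x<..<y}) (E d)" if "d \<in> D" for d
      using that by (auto simp: interval_families_def)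
    \<comment> \<open>The index records the surrounding interval as well, because a degenerate
      subinterval can belong to two of the families.\<close>
    have "(\<Sum>i\<in>Sigma D E. \<bar>f (snd (snd i)) - f (fst (snd i))\<bar>) < \<epsilon> / 2"
    proof (rule S)
      show "disjoint_family_on (\<lambda>i. {fst (snd i)<..<snd (snd i)}) (Sigma D E)"
        unfolding disjoint_family_on_def
      proof (intro ballI impI)
        fix i j assume ij: "i \<in> Sigma D E" "j \<in> Sigma D E" "i \<noteq> j"
        then obtain d e d' e' where eq: "i = (d, e)" "j = (d', e')" "d \<in> D" "d' \<in> D" "e \<in> E d" "e' \<in> E d'"
          by (metis SigmaE)
        show "{fst (snd i)<..<snd (snd i)} \<inter> {fst (snd j)<..<snd (snd j)} = {}"
        proof (cases "d = d'")
          case True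
          then show ?thesis
            using disjoint_family_onD[OF E'(3)[OF eq(3)], of e e'] eq ij by (simp add: case_prod_unfold)
        next
          case False
          then have "{fst d<..<snd d} \<inter> {fst d'<..<snd d'} = {}"
            using disjoint_family_onD[OF D(3), of d d'] eq by (simp add: case_prod_unfold)
          moreover have "{fst e<..<snd e} \<subseteq> {fst d<..<snd d}" "{fst e'<..<snd e'} \<subseteq> {fst d'<..<snd d'}"
            using E'(2)[OF eq(3)] E'(2)[OF eq(4)] eq(5,6) by force+
          ultimately show ?thesis unfolding eq fst_conv snd_conv by blast
        qed
      qed
      have "(\<Sum>i\<in>Sigma D E. snd (snd i) - fst (snd i)) = (\<Sum>d\<in>D. \<Sum>e\<in>E d. snd e - fst e)"
        using D(1) E'(1) by (subst sum.Sigma) (auto simp: case_prod_unfold)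
      also have "\<dots> \<le> (\<Sum>d\<in>D. snd d - fst d)"
      proof (rule sum_mono)
        fix d assume d: "d \<in> D"
        show "(\<Sum>e\<in>E d. snd e - fst e) \<le> snd d - fst d"
          using E'[OF d] D2[OF d]
          by (intro sum_disjoint_interval_lengths_le) (auto simp: case_prod_unfold)
      qed
      also have "\<dots> < \<delta>" using D(4) by (simp add: case_prod_unfold)
      finally show "(\<Sum>i\<in>Sigma D E. snd (snd i) - fst (snd i)) < \<delta>" .
      fix i assume "i \<in> Sigma D E"
      then show "a \<le> fst (snd i) \<and> fst (snd i) \<le> snd (snd i) \<and> snd (snd i) \<le> b"
        using D2 E'(2) by force
    qed (use D(1) E'(1) in auto)
    also have "(\<Sum>i\<in>Sigma D E. \<bar>f (snd (snd i)) - f (fst (snd i))\<bar>) = (\<Sum>d\<in>D. family_variation f (E d))"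
      unfolding family_variation_def
      using D(1) E'(1) by (subst sum.Sigma) (auto simp: case_prod_unfold)
    finally have small: "(\<Sum>d\<in>D. family_variation f (E d)) < \<epsilon> / 2" .
    have "(\<Sum>(u, v)\<in>D. \<bar>variation f a v - variation f a u\<bar>) \<le> (\<Sum>d\<in>D. family_variation f (E d) + \<eta>)"
    proof (rule sum_mono)
      fix d assume d: "d \<in> D"
      show "(case d of (u, v) \<Rightarrow> \<bar>variation f a v - variation f a u\<bar>) \<le> family_variation f (E d) + \<eta>"
        using variation_increment_ge[OF D2[OF d]] variation_le_add[OF D2[OF d]] E(2)[OF d]
        by (simp add: case_prod_unfold)
    qed
    also have "\<dots> = (\<Sum>d\<in>D. family_variation f (E d)) + real (card D) * \<eta>"
      by (simp add: sum.distrib)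
    also have "real (card D) * \<eta> \<le> \<epsilon> / 2"
      using \<open>\<epsilon> > 0\<close> by (simp add: \<eta>_def field_simps)
    finally show ?thesis using small by simp
  qed
  then show "\<exists>\<delta>>0. \<forall>D. finite D \<longrightarrow> (\<forall>(u, v)\<in>D. a \<le> u \<and> u \<le> v \<and> v \<le> b) \<longrightarrow>
      disjoint_family_on (\<lambda>(u, v). {u<..<v}) D \<longrightarrow> (\<Sum>(u, v)\<in>D. v - u) < \<delta> \<longrightarrow>
      (\<Sum>(u, v)\<in>D. \<bar>variation f a v - variation f a u\<bar>) < \<epsilon>"
    using \<delta> by (intro exI[of _ \<delta>] conjI allI impI)
qed

end

section \<open>Densities of Stieltjes measures\<close>

lemma emeasure_countable_Union_le:
  assumes D: "countable D" "D \<subseteq> sets M"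
    and fin: "\<And>F. finite F \<Longrightarrow> F \<subseteq> D \<Longrightarrow> emeasure M (\<Union>F) \<le> e"
  shows "emeasure M (\<Union>D) \<le> e"
proof (cases "D = {}")
  case False
  \<comment> \<open>Finite unions that increase to the whole union; \<open>from_nat_into\<close>
    also enumerates a finite nonempty \<open>D\<close>, with repetitions.\<close>
  let ?F = "\<lambda>n::nat. from_nat_into D ` {..n}"
  have sub: "?F n \<subseteq> D" for n using False by (auto intro: from_nat_into)
  have "(SUP n. emeasure M (\<Union>(?F n))) = emeasure M (\<Union>n. \<Union>(?F n))"
  proof (rule SUP_emeasure_incseq)
    show "range (\<lambda>n. \<Union>(?F n)) \<subseteq> sets M"
    proof clarify
      fix n show "\<Union>(?F n) \<in> sets M"
        by (rule sets.finite_Union) (use sub[of n] D(2) in \<open>simp, rule order_trans\<close>)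
    qed
    show "incseq (\<lambda>n. \<Union>(?F n))"
      by (intro monoI Union_mono image_mono) simp
  qed
  also have "(\<Union>n. \<Union>(?F n)) = \<Union>D"
  proof (rule equalityI)
    show "\<Union>D \<subseteq> (\<Union>n. \<Union>(?F n))"
    proof
      fix x assume "x \<in> \<Union>D"
      then obtain A where "A \<in> D" "x \<in> A" by (rule UnionE)
      moreover from this obtain n where "from_nat_into D n = A"
        using from_nat_into_surj[OF D(1)] by blast
      ultimately show "x \<in> (\<Union>n. \<Union>(?F n))" by auto
    qed
  qed (use sub in \<open>intro UN_least Union_mono\<close>)
  finally have "emeasure M (\<Union>D) = (SUP n. emeasure M (\<Union>(?F n)))" ..
  also have "\<dots> \<le> e"
    by (rule SUP_least, rule fin[OF _ sub]) simp
  finally show ?thesis .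
qed (use fin[of "{}"] in auto)

text \<open>Cover \<open>N\<close> by countably many nonoverlapping intervals of total length below
  \<open>\<delta>\<close>. By absolute continuity any finitely many of them have mass at most
  \<open>e\<close>, hence so does their union, although \<open>e\<close> was chosen below the mass
  of \<open>N\<close>.\<close>

lemma mono_abs_continuous_null_set:
  fixes H :: "real \<Rightarrow> real"
  assumes H: "mono H" "continuous_on UNIV H" and AC: "abs_continuous_on_interval a b H"
    and N: "N \<in> null_sets lborel" "N \<subseteq> {a..b}"
  shows "emeasure (interval_measure H) N = 0"
proof (rule ccontr)
  let ?\<nu> = "interval_measure H"
  assume "emeasure ?\<nu> N \<noteq> 0"
  have mono: "\<And>x y. x \<le> y \<Longrightarrow> H x \<le> H y" using H(1) by (auto simp: mono_def)
  \<comment> \<open>Continuity of \<open>H\<close> excludes atoms, so a closed interval has the mass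
    of the half-open one.\<close>
  have Icc: "emeasure ?\<nu> {x..y} = ennreal (H y - H x)" if "x \<le> y" for x y
    using that mono H(2) by (rule emeasure_interval_measure_Icc)
  obtain e :: real where e: "e > 0" "ennreal e < emeasure ?\<nu> N"
  proof -
    obtain y where "0 < y" "y < emeasure ?\<nu> N"
      using \<open>emeasure ?\<nu> N \<noteq> 0\<close> dense[of 0 "emeasure ?\<nu> N"] by (auto simp: zero_less_iff_neq_zero)
    then show thesis by (cases y) (auto intro: that)
  qed
  obtain \<delta> where \<delta>: "\<delta> > 0" and
    S: "\<And>(I :: real set set) u v.
        \<lbrakk>finite I; \<And>i. i \<in> I \<Longrightarrow> a \<le> u i \<and> u i \<le> v i \<and> v i \<le> b;
        disjoint_family_on (\<lambda>i. {u i<..<v i}) I; (\<Sum>i\<in>I. v i - u i) < \<delta>\<rbrakk>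
      \<Longrightarrow> (\<Sum>i\<in>I. \<bar>H (v i) - H (u i)\<bar>) < e"
    by (rule abs_continuous_on_interval_indexed[OF AC e(1), where 'i = "real set"]) (rule that, blast+)
  have Nb: "N \<in> sets borel" using N(1) by auto
  have Nl: "N \<in> lmeasurable" "measure lebesgue N = 0"
    using N(1) null_sets_completionI[of N lborel]
    by (auto intro: negligible_imp_measurable simp: negligible_iff_null_sets measure_def) 
  have "\<delta> / 2 > 0" using \<delta> by simp
  \<comment> \<open>The cover lies inside [a, b], where \<open>H\<close> is known to be absolutely
    continuous. Only the interiors are disjoint, which is what \<open>S\<close> asks for.\<close>
  obtain \<D> where \<D>: "countable \<D>"
        "\<And>K. K \<in> \<D> \<Longrightarrow> K \<subseteq> cbox a b \<and> K \<noteq> {} \<and> (\<exists>c d. K = cbox c d)"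
        "pairwise (\<lambda>A B. interior A \<inter> interior B = {}) \<D>"
        "N \<subseteq> \<Union>\<D>" "\<Union>\<D> \<in> lmeasurable" "measure lebesgue (\<Union>\<D>) \<le> measure lebesgue N + \<delta> / 2"
    using measurable_outer_intervals_bounded[OF Nl(1) _ \<open>\<delta> / 2 > 0\<close>, of a b] N(2)
    by (metis box_real(2))
  have "\<forall>K\<in>\<D>. \<exists>l r. l \<le> r \<and> K = {l..r} \<and> a \<le> l \<and> r \<le> b"
  proof
    fix K assume "K \<in> \<D>"
    from \<D>(2)[OF this] obtain c d where "K = {c..d}" "{c..d} \<noteq> {}" "{c..d} \<subseteq> {a..b}" by auto
    then show "\<exists>l r. l \<le> r \<and> K = {l..r} \<and> a \<le> l \<and> r \<le> b" by auto
  qed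
  then obtain l r where lr: "\<And>K. K \<in> \<D> \<Longrightarrow> l K \<le> r K \<and> K = {l K..r K} \<and> a \<le> l K \<and> r K \<le> b"
    by metis
  have fin: "(\<Sum>K\<in>F. H (r K) - H (l K)) \<le> e" if F: "finite F" "F \<subseteq> \<D>" for F
  proof -
    have int: "interior K = {l K<..<r K}" if "K \<in> F" for K
      using lr[of K] F that by (metis interior_atLeastAtMost_real subsetD)
    have "(\<Sum>K\<in>F. \<bar>H (r K) - H (l K)\<bar>) < e"
    proof (rule S[OF F(1)])
      show dj: "disjoint_family_on (\<lambda>K. {l K<..<r K}) F"
        unfolding disjoint_family_on_def
      proof (intro ballI impI)
        fix K L assume "K \<in> F" "L \<in> F" "K \<noteq> L"
        then show "{l K<..<r K} \<inter> {l L<..<r L} = {}"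
          using \<D>(3) F(2) int[of K] int[of L] unfolding pairwise_def by (metis subsetD)
      qed
      have "(\<Sum>K\<in>F. r K - l K) = (\<Sum>K\<in>F. measure lebesgue {l K<..<r K})"
        using lr F(2) by (intro sum.cong) auto
      also have "\<dots> = measure lebesgue (\<Union>K\<in>F. {l K<..<r K})"
        using dj by (intro measure_UNION'[symmetric] F) (auto simp: disjoint_family_on_def pairwise_def disjnt_def)
      also have "\<dots> \<le> measure lebesgue (\<Union>\<D>)"
      proof (intro measure_mono_fmeasurable \<D>(5))
        show "(\<Union>K\<in>F. {l K<..<r K}) \<subseteq> \<Union>\<D>"
        proof
          fix x assume "x \<in> (\<Union>K\<in>F. {l K<..<r K})"
          then obtain K where "K \<in> F" "x \<in> {l K..r K}" by auto
          then show "x \<in> \<Union>\<D>" using lr[of K] F(2) by blast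
        qed
      qed (use F(1) in auto)
      also have "\<dots> < \<delta>" using \<D>(6) Nl(2) \<delta> by simp
      finally show "(\<Sum>K\<in>F. r K - l K) < \<delta>" .
    qed (use lr F(2) in auto)
    moreover have "(\<Sum>K\<in>F. H (r K) - H (l K)) \<le> (\<Sum>K\<in>F. \<bar>H (r K) - H (l K)\<bar>)"
      by (intro sum_mono abs_ge_self)
    ultimately show ?thesis by simp
  qed
  have "\<D> \<subseteq> sets ?\<nu>"
  proof
    fix K assume "K \<in> \<D>"
    then have "K = {l K..r K}" using lr by blast
    then show "K \<in> sets ?\<nu>" by (metis atLeastAtMost_borel sets_interval_measure)
  qed
  then have "emeasure ?\<nu> N \<le> emeasure ?\<nu> (\<Union>\<D>)"
    using \<D>(1,4) by (intro emeasure_mono sets.countable_Union)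
  also have "\<dots> \<le> ennreal e"
  proof (rule emeasure_countable_Union_le[OF \<D>(1) \<open>\<D> \<subseteq> sets ?\<nu>\<close>])
    fix F assume F: "finite F" "F \<subseteq> \<D>"
    have "emeasure ?\<nu> (\<Union>F) \<le> (\<Sum>K\<in>F. emeasure ?\<nu> K)"
      using F \<open>\<D> \<subseteq> sets ?\<nu>\<close> emeasure_subadditive_finite[of F "\<lambda>K. K" ?\<nu>] by auto
    also have "\<dots> = (\<Sum>K\<in>F. ennreal (H (r K) - H (l K)))"
      using lr F(2) Icc by (intro sum.cong) (auto, metis subsetD)
    also have "\<dots> = ennreal (\<Sum>K\<in>F. H (r K) - H (l K))"
      using lr F(2) mono by (intro sum_ennreal) auto
    also have "\<dots> \<le> ennreal e" using fin[OF F] by (rule ennreal_leI)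
    finally show "emeasure ?\<nu> (\<Union>F) \<le> ennreal e" .
  qed
  finally show False using e(2) by simp
qed

text \<open>The Stieltjes measure of \<open>h\<close> vanishes on Lebesgue null sets, so
  Radon-Nikodym provides a density, and half-open intervals recover the increments of
  \<open>h\<close>.\<close>

lemma mono_abs_continuous_density:
  fixes h :: "real \<Rightarrow> real"
  assumes ab: "a \<le> b" and mono: "\<And>x y. a \<le> x \<Longrightarrow> x \<le> y \<Longrightarrow> y \<le> b \<Longrightarrow> h x \<le> h y"
    and AC: "abs_continuous_on_interval a b h"
  obtains g where "integrable lborel g"
    "\<And>x y. a \<le> x \<Longrightarrow> x \<le> y \<Longrightarrow> y \<le> b \<Longrightarrow> h y - h x = (LINT t:{x..y}|lborel. g t)"
proof -
  \<comment> \<open>Constant continuation beyond [a, b] yields the monotone continuous function on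
    the whole line that \<open>interval_measure\<close> calls for.\<close>
  define H where "H x = h (max a (min b x))" for x
  have H: "H x \<le> H y" if "x \<le> y" for x y
    unfolding H_def using ab that by (intro mono) auto
  have "continuous_on UNIV H"
    unfolding H_def using ab
    by (intro continuous_on_compose2[OF abs_continuous_on_interval_imp_continuous_on[OF AC]] continuous_intros) auto
  have Hh: "H x = h x" if "a \<le> x" "x \<le> b" for x using that by (simp add: H_def)
  have "abs_continuous_on_interval a b H"
    unfolding abs_continuous_on_interval_def
  proof (intro allI impI)
    fix \<epsilon> :: real assume "\<epsilon> > 0"
    obtain \<delta> where \<delta>: "\<delta> > 0" and
      D: "\<And>D. \<lbrakk>finite D; \<forall>(u, v)\<in>D. a \<le> u \<and> u \<le> v \<and> v \<le> b;
        disjoint_family_on (\<lambda>(u, v). {u<..<v}) D; (\<Sum>(u, v)\<in>D. v - u) < \<delta>\<rbrakk>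
        \<Longrightarrow> (\<Sum>(u, v)\<in>D. \<bar>h v - h u\<bar>) < \<epsilon>"
      by (rule abs_continuous_on_intervalE[OF AC \<open>\<epsilon> > 0\<close>]) (rule that)
    have "(\<Sum>(u, v)\<in>D. \<bar>H v - H u\<bar>) = (\<Sum>(u, v)\<in>D. \<bar>h v - h u\<bar>)" if "\<forall>(u, v)\<in>D. a \<le> u \<and> u \<le> v \<and> v \<le> b" for D
      using that by (intro sum.cong) (auto simp: Hh)
    with D \<delta> show "\<exists>\<delta>>0. \<forall>D. finite D \<longrightarrow> (\<forall>(u, v)\<in>D. a \<le> u \<and> u \<le> v \<and> v \<le> b) \<longrightarrow>
      disjoint_family_on (\<lambda>(u, v). {u<..<v}) D \<longrightarrow> (\<Sum>(u, v)\<in>D. v - u) < \<delta> \<longrightarrow>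
      (\<Sum>(u, v)\<in>D. \<bar>H v - H u\<bar>) < \<epsilon>"
      by (intro exI[of _ \<delta>] conjI allI impI) simp_all
  qed
  note null = mono_abs_continuous_null_set[OF monoI[OF H] \<open>continuous_on UNIV H\<close> this]
  \<comment> \<open>Cutting down to \<open>{a<..b}\<close> brings every null set within reach of
    \<open>null\<close>, which speaks of subsets of [a, b].\<close>
  define \<nu> where "\<nu> = density (interval_measure H) (indicator {a<..b})"
  have sets: "sets \<nu> = sets lborel" by (simp add: \<nu>_def)
  have em: "emeasure \<nu> A = emeasure (interval_measure H) ({a<..b} \<inter> A)" if "A \<in> sets borel" for A
    unfolding \<nu>_def using that
    by (subst emeasure_density) (auto simp: indicator_inter_arith[symmetric] ac_simps nn_integral_indicator)
  have Ioc: "emeasure (interval_measure H) {x<..y} = ennreal (H y - H x)" if "x \<le> y" for x y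
    using that H \<open>continuous_on UNIV H\<close>
    by (intro emeasure_interval_measure_Ioc) (auto simp: continuous_on_eq_continuous_at continuous_at_imp_continuous_within)
  have "absolutely_continuous lborel \<nu>"
    unfolding absolutely_continuous_def
  proof
    fix N :: "real set" assume N: "N \<in> null_sets lborel"
    then have "emeasure (interval_measure H) ({a<..b} \<inter> N) = 0"
      by (intro null null_set_Int1) auto
    with N show "N \<in> null_sets \<nu>"
      by (auto intro!: null_setsI simp: em sets)
  qed
  from sigma_finite_measure.Radon_Nikodym[OF sigma_finite_lborel this sets] obtain \<phi>
    where \<phi>: "\<phi> \<in> borel_measurable lborel" "density lborel \<phi> = \<nu>" by blast
  have int: "(\<integral>\<^sup>+t. \<phi> t * indicator A t \<partial>lborel) = emeasure \<nu> A" if "A \<in> sets borel" for A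
    using \<phi> that by (metis emeasure_density sets_lborel)
  have "(\<integral>\<^sup>+t. \<phi> t \<partial>lborel) = ennreal (H b - H a)"
    using int[of UNIV] em[of UNIV] Ioc[OF ab] by simp
  then have fin: "(\<integral>\<^sup>+t. \<phi> t \<partial>lborel) \<noteq> \<infinity>" by simp
  \<comment> \<open>\<open>enn2real\<close> sends infinity to 0; as the total mass is finite, this
    alters \<open>\<phi>\<close> on a null set only.\<close>
  define g where "g = (\<lambda>t. enn2real (\<phi> t))"
  have g: "g \<in> borel_measurable lborel" using \<phi>(1) by (simp add: g_def)
  have ae: "AE t in lborel. ennreal (g t) = \<phi> t"
    using nn_integral_PInf_AE[OF \<phi>(1) fin] by eventually_elim (auto simp: g_def less_top)
  have gi: "(\<integral>\<^sup>+t. ennreal (g t) \<partial>lborel) = (\<integral>\<^sup>+t. \<phi> t \<partial>lborel)"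
    using ae by (intro nn_integral_cong_AE) auto
  have "integrable lborel g"
    using fin gi g by (intro integrableI_nonneg) (auto simp: g_def less_top)
  moreover have "h y - h x = (LINT t:{x..y}|lborel. g t)" if xy: "a \<le> x" "x \<le> y" "y \<le> b" for x y
  proof -
    have "(LINT t:{x..y}|lborel. g t) = (LINT t:{x<..y}|lborel. g t)"
      unfolding set_lebesgue_integral_def
    proof (rule integral_cong_AE)
      show "AE t in lborel. indicat_real {x..y} t *\<^sub>R g t = indicat_real {x<..y} t *\<^sub>R g t"
        using AE_lborel_singleton[of x] by eventually_elim (auto simp: indicator_def)
    qed (use g in measurable)
    also have "\<dots> = enn2real (\<integral>\<^sup>+t. ennreal (indicator {x<..y} t * g t) \<partial>lborel)"
      unfolding set_lebesgue_integral_def real_scaleR_def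
    proof (rule integral_eq_nn_integral)
      show "(\<lambda>t. indicat_real {x<..y} t * g t) \<in> borel_measurable lborel"
        using g by measurable
    qed (simp add: g_def)
    also have "(\<integral>\<^sup>+t. ennreal (indicator {x<..y} t * g t) \<partial>lborel) = (\<integral>\<^sup>+t. \<phi> t * indicator {x<..y} t \<partial>lborel)"
      by (rule nn_integral_cong_AE, use ae in eventually_elim) (simp split: split_indicator)
    also have "\<dots> = ennreal (h y - h x)"
    proof -
      have "{a<..b} \<inter> {x<..y} = {x<..y}" using xy by auto
      then show ?thesis using int[of "{x<..y}"] em[of "{x<..y}"] Ioc[of x y] xy by (simp add: Hh)
    qed
    finally show ?thesis using mono[OF xy] by simp
  qed
  ultimately show thesis using that by blast
qed

text \<open>Write \<open>f\<close> as the difference of the nondecreasing functions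
  \<open>?V\<close> and \<open>?V - f\<close>, both absolutely continuous, and subtract their
  densities.\<close>

lemma abs_continuous_density:
  assumes ab: "a \<le> b" and AC: "abs_continuous_on_interval a b f"
  obtains g where "integrable lborel g"
    "\<And>x y. a \<le> x \<Longrightarrow> x \<le> y \<Longrightarrow> y \<le> b \<Longrightarrow> f y - f x = (LINT t:{x..y}|lborel. g t)"
proof -
  let ?V = "variation f a"
  have V: "\<bar>f y - f x\<bar> \<le> ?V y - ?V x" if "a \<le> x" "x \<le> y" "y \<le> b" for x y
    using variation_increment_ge[OF ab AC that] .
  have ACV: "abs_continuous_on_interval a b ?V" using abs_continuous_variation[OF ab AC] .
  have mV: "?V x \<le> ?V y" "?V x - f x \<le> ?V y - f y" if "a \<le> x" "x \<le> y" "y \<le> b" for x y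
    using V[OF that] by linarith+
  obtain g1 where g1: "integrable lborel g1"
    "\<And>x y. a \<le> x \<Longrightarrow> x \<le> y \<Longrightarrow> y \<le> b \<Longrightarrow> ?V y - ?V x = (LINT t:{x..y}|lborel. g1 t)"
    by (rule mono_abs_continuous_density[OF ab mV(1) ACV]) (assumption+, rule that, blast+)
  obtain g2 where g2: "integrable lborel g2"
    "\<And>x y. a \<le> x \<Longrightarrow> x \<le> y \<Longrightarrow> y \<le> b \<Longrightarrow> (?V y - f y) - (?V x - f x) = (LINT t:{x..y}|lborel. g2 t)"
    by (rule mono_abs_continuous_density[OF ab mV(2) abs_continuous_on_interval_diff[OF ACV AC]]) (assumption+, rule that, blast+)
  show thesis
  proof
    show "integrable lborel (\<lambda>t. g1 t - g2 t)" using g1 g2 by simp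
    fix x y assume xy: "a \<le> x" "x \<le> y" "y \<le> b"
    have "set_integrable lborel {x..y} g1" "set_integrable lborel {x..y} g2"
      using g1(1) g2(1) unfolding set_integrable_def by (auto intro: integrable_mult_indicator simp del: real_scaleR_def)
    then have "(LINT t:{x..y}|lborel. g1 t - g2 t) = (?V y - ?V x) - ((?V y - f y) - (?V x - f x))"
      using g1(2)[OF xy] g2(2)[OF xy] by (simp add: set_integral_diff)
    then show "f y - f x = (LINT t:{x..y}|lborel. g1 t - g2 t)" by simp
  qed
qed

section \<open>Differentiation of indefinite integrals\<close>

lemma exists_open_small_excess_integral:
  fixes w :: "real \<Rightarrow> real"
  assumes w: "integrable lborel w" "\<And>x. 0 \<le> w x" and A: "A \<in> sets borel" and e: "e > 0"
  obtains U where "open U" "A \<subseteq> U" "(LINT t:U - A|lborel. w t) \<le> e"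
proof -
  \<comment> \<open>The measure with density \<open>w\<close> is finite, hence outer regular, which
    supplies the open set.\<close>
  define M where "M = density lborel (\<lambda>t. ennreal (w t))"
  have sM: "sets M = sets borel" by (simp add: M_def)
  have wm: "w \<in> borel_measurable lborel" using w by auto
  have em: "emeasure M B = ennreal (LINT t:B|lborel. w t)" if "B \<in> sets borel" for B
  proof -
    have "emeasure M B = (\<integral>\<^sup>+t. ennreal (w t) * indicator B t \<partial>lborel)"
      unfolding M_def using wm that by (intro emeasure_density) auto
    also have "\<dots> = (\<integral>\<^sup>+t. ennreal (indicator B t *\<^sub>R w t) \<partial>lborel)"
      by (intro nn_integral_cong) (simp split: split_indicator)
    also have "\<dots> = ennreal (LINT t:B|lborel. w t)"
      unfolding set_lebesgue_integral_def using w that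
      by (intro nn_integral_eq_integral integrable_mult_indicator) auto
    finally show ?thesis .
  qed
  have fin: "emeasure M (space M) \<noteq> \<infinity>"
    using em[of UNIV] by (simp add: M_def)
  have "emeasure M A < emeasure M A + ennreal e"
    using em[OF A] e by (simp add: ennreal_less_top less_top[symmetric])
  then have "(INF U\<in>{U. A \<subseteq> U \<and> open U}. emeasure M U) < emeasure M A + ennreal e"
    using outer_regular[OF sM fin A] by simp
  then obtain U where U: "A \<subseteq> U" "open U" "emeasure M U < emeasure M A + ennreal e"
    unfolding INF_less_iff by auto
  have Ub: "U \<in> sets borel" using U(2) by simp
  have si: "set_integrable lborel B w" if "B \<in> sets borel" for B
    unfolding set_integrable_def using w(1) that by (intro integrable_mult_indicator) auto
  have "U = A \<union> (U - A)" using U(1) by blast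
  then have "(LINT t:U|lborel. w t) = (LINT t:A|lborel. w t) + (LINT t:U - A|lborel. w t)"
    using set_integral_Un[OF _ si si, of A "U - A"] A Ub by auto
  moreover have A0: "0 \<le> (LINT t:A|lborel. w t)"
    using w(2) by (simp add: set_lebesgue_integral_def)
  moreover have "ennreal (LINT t:U|lborel. w t) \<le> ennreal ((LINT t:A|lborel. w t) + e)"
    using U(3) em[OF A] em[OF Ub] ennreal_plus[OF A0, of e] e by simp
  then have "(LINT t:U|lborel. w t) \<le> (LINT t:A|lborel. w t) + e"
    using A0 e by (subst (asm) ennreal_le_iff) auto
  ultimately have "(LINT t:U - A|lborel. w t) \<le> e" by simp
  with U that show thesis by blast
qed

context
  fixes f g :: "real \<Rightarrow> real"
  assumes g: "integrable lborel g"
    and f: "\<And>x y. x \<le> y \<Longrightarrow> f y - f x = (LINT t:{x..y}|lborel. g t)"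
begin

text \<open>A quotient above \<open>q\<close> says that \<open>g\<close> has mean above
  \<open>q\<close> on the interval between \<open>x\<close> and \<open>y\<close>. Such intervals
  form a Vitali cover of the exceptional set; the mean values on a disjoint subfamily conflict with
  \<open>g < p\<close> unless its total length is small.\<close>

lemma negligible_steep_difference_quotients:
  assumes pq: "p < q"
  shows "negligible {x. g x < p \<and> (\<forall>d>0. \<exists>y. y \<noteq> x \<and> \<bar>y - x\<bar> < d \<and> q < (f y - f x) / (y - x))}"
    (is "negligible ?E")
proof -
  have gm [measurable]: "g \<in> borel_measurable lborel" using g by auto
  \<comment> \<open>On bounded pieces the constant \<open>p\<close> is integrable.\<close>
  have "negligible (?E \<inter> {-real n<..<real n})" for n :: nat
    unfolding negligible_outer_le
  proof (intro allI impI)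
    fix e :: real assume "e > 0"
    define S where "S = ?E \<inter> {-real n<..<real n}"
    define A where "A = {x \<in> {-real n<..<real n}. g x < p}"
    define w where "w x = indicator {-real n<..<real n} x *\<^sub>R \<bar>g x - p\<bar>" for x
    have A: "A \<in> sets borel"
    proof -
      have "{x \<in> space lborel. g x < p} \<in> sets lborel" by measurable
      then have "{-real n<..<real n} \<inter> {x. g x < p} \<in> sets borel" by simp
      then show ?thesis by (simp add: A_def Int_def)
    qed
    have gp: "set_integrable lborel B (\<lambda>x. g x - p)" if "B \<in> sets borel" "B \<subseteq> {-real n<..<real n}" for B
    proof -
      have "set_integrable lborel {-real n<..<real n} (\<lambda>x. p)"
        unfolding set_integrable_def by (intro integrable_scaleR_left integrable_real_indicator) auto
      moreover have "set_integrable lborel {-real n<..<real n} g"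
        unfolding set_integrable_def using g by (intro integrable_mult_indicator) auto
      ultimately have "set_integrable lborel {-real n<..<real n} (\<lambda>x. g x - p)"
        by (intro set_integral_diff)
      then show ?thesis by (rule set_integrable_subset) (use that in auto)
    qed
    have w: "integrable lborel w"
      using set_integrable_abs[OF gp[of "{-real n<..<real n}"]] unfolding w_def set_integrable_def by simp
    \<comment> \<open>The last step divides by \<open>q - p\<close>, which turns \<open>e'\<close>
      into \<open>e\<close>.\<close>
    define e' where "e' = e * (q - p)"
    have "e' > 0" using \<open>e > 0\<close> pq by (simp add: e'_def)
    \<comment> \<open>\<open>g - p\<close> is negative on \<open>A\<close>, so its integral over any subset of \<open>U\<close> is at most \<open>e'\<close>, while over the
      disjoint Vitali intervals it exceeds \<open>q - p\<close> times their length; thus no measurability of the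
      exceptional set is needed\<close>
    obtain U0 where U0: "open U0" "A \<subseteq> U0" "(LINT t:U0 - A|lborel. w t) \<le> e'"
      using exists_open_small_excess_integral[OF w _ A \<open>e' > 0\<close>] by (auto simp: w_def)
    define U where "U = U0 \<inter> {-real n<..<real n}"
    have U: "open U" "A \<subseteq> U" "U \<subseteq> {-real n<..<real n}" using U0 by (auto simp: U_def A_def)
    have small: "(LINT t:W|lborel. g t - p) \<le> e'" if W: "W \<in> sets borel" "W \<subseteq> U" for W
    proof -
      have "(LINT t:W|lborel. g t - p) \<le> (LINT t:U0 - A|lborel. w t)"
        unfolding set_lebesgue_integral_def
      proof (rule integral_mono)
        show "integrable lborel (\<lambda>t. indicat_real W t *\<^sub>R (g t - p))"
          using gp[OF W(1)] W(2) U(3) unfolding set_integrable_def by blast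
        show "integrable lborel (\<lambda>t. indicat_real (U0 - A) t *\<^sub>R w t)"
          using w U0(1) A by (intro integrable_mult_indicator) auto
        fix t show "indicat_real W t *\<^sub>R (g t - p) \<le> indicat_real (U0 - A) t *\<^sub>R w t"
          using W(2) by (auto simp: w_def U_def A_def indicator_def)
      qed
      with U0(3) show ?thesis by simp
    qed
    define K where "K = {(c, r). 0 < r \<and> cball c r \<subseteq> U \<and> q * (2 * r) < (LINT t:cball c r|lborel. g t)}"
    have cov: "\<exists>i. i \<in> K \<and> x \<in> cball (fst i) (snd i) \<and> snd i < d" if x: "x \<in> S" and d: "d > 0" for x d
    proof -
      have "x \<in> U" using x U(2) by (auto simp: S_def A_def)
      then obtain d0 where d0: "d0 > 0" "ball x d0 \<subseteq> U" using U(1) openE by blast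
      obtain y where y: "y \<noteq> x" "\<bar>y - x\<bar> < min d d0" "q < (f y - f x) / (y - x)"
      proof -
        have "\<forall>d>0. \<exists>y. y \<noteq> x \<and> \<bar>y - x\<bar> < d \<and> q < (f y - f x) / (y - x)"
          using x by (simp add: S_def)
        moreover have "min d d0 > 0" using d d0 by simp
        ultimately have "\<exists>y. y \<noteq> x \<and> \<bar>y - x\<bar> < min d d0 \<and> q < (f y - f x) / (y - x)"
          by (elim allE impE)
        then show thesis using that by (elim exE conjE)
      qed
      \<comment> \<open>The Vitali theorem is about balls. This one is the closed interval between
        \<open>x\<close> and \<open>y\<close>, so \<open>x\<close> is an endpoint and not the
        centre.\<close>
      define c r where "c = (x + y) / 2" and "r = \<bar>y - x\<bar> / 2"
      have cb: "cball c r = {min x y..max x y}"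
        unfolding cball_eq_atLeastAtMost c_def r_def by (auto simp: min_def max_def abs_if field_simps)
      have "q * (2 * r) < f (max x y) - f (min x y)"
        using y(1,3) by (cases "x < y") (auto simp: r_def min_def max_def abs_if field_simps)
      then have "q * (2 * r) < (LINT t:cball c r|lborel. g t)"
        using f[of "min x y" "max x y"] by (simp add: cb)
      moreover have "cball c r \<subseteq> ball x d0" using y(2) by (auto simp: cb dist_real_def)
      ultimately have "(c, r) \<in> K" using y(1) d0(2) by (auto simp: K_def r_def)
      moreover have "x \<in> cball c r" by (simp add: cb)
      moreover have "r < d" using y(2) d by (simp add: r_def)
      ultimately show ?thesis by (metis fst_conv snd_conv)
    qed
    obtain C where C: "countable C" "C \<subseteq> K"
      "pairwise (\<lambda>i j. disjnt (cball (fst i) (snd i)) (cball (fst j) (snd j))) C"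
      "negligible (S - (\<Union>i\<in>C. cball (fst i) (snd i)))"
    proof (rule Vitali_covering_theorem_cballs[of K snd S fst])
      show "0 < snd i" if "i \<in> K" for i using that by (auto simp: K_def)
      show "\<exists>i. i \<in> K \<and> x \<in> cball (fst i) (snd i) \<and> snd i < d" if "x \<in> S" "0 < d" for x d
        by (rule cov[OF that])
    qed (rule that)
    let ?W = "\<Union>i\<in>C. cball (fst i) (snd i)"
    have "emeasure lborel ?W \<le> ennreal e"
    proof (rule emeasure_countable_Union_le)
      fix F' assume "finite F'" "F' \<subseteq> (\<lambda>i. cball (fst i) (snd i)) ` C"
      then obtain F where F: "finite F" "F \<subseteq> C" "F' = (\<lambda>i. cball (fst i) (snd i)) ` F"
        by (meson finite_subset_image)
      let ?V = "\<Union>i\<in>F. cball (fst i) (snd i)"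
      have K: "0 < snd i" "cball (fst i) (snd i) \<subseteq> U"
        "q * (2 * snd i) < (LINT t:cball (fst i) (snd i)|lborel. g t)" if "i \<in> F" for i
      proof -
        have "i \<in> K" using that F(2) C(2) by blast
        then show "0 < snd i" "cball (fst i) (snd i) \<subseteq> U"
          "q * (2 * snd i) < (LINT t:cball (fst i) (snd i)|lborel. g t)"
          by (simp_all add: K_def case_prod_unfold)
      qed
      have pw: "pairwise (\<lambda>i j. disjnt (cball (fst i) (snd i)) (cball (fst j) (snd j))) F"
        using C(3) F(2) by (rule pairwise_subset)
      then have dj: "disjoint_family_on (\<lambda>i. cball (fst i) (snd i)) F"
        unfolding pairwise_def disjoint_family_on_def disjnt_def .
      have len: "measure lborel (cball (fst i) (snd i)) = 2 * snd i" if "i \<in> F" for i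
        using K(1)[OF that] by (simp add: cball_eq_atLeastAtMost)
      have fm: "cball (fst i) (snd i) \<in> fmeasurable lborel" for i :: "real \<times> real"
        using emeasure_lborel_cball_finite[of "fst i" "snd i"] unfolding fmeasurable_def by simp
      have "measure lborel ?V = (\<Sum>i\<in>F. 2 * snd i)"
        using measure_UNION'[OF F(1) fm pw] len by simp
      then have "(q - p) * measure lborel ?V = (\<Sum>i\<in>F. q * (2 * snd i) - p * (2 * snd i))"
        by (simp add: sum_distrib_left algebra_simps sum_subtractf)
      also have "\<dots> \<le> (\<Sum>i\<in>F. (LINT t:cball (fst i) (snd i)|lborel. g t - p))"
      proof (rule sum_mono)
        fix i assume i: "i \<in> F"
        let ?B = "cball (fst i) (snd i)"
        have "set_integrable lborel ?B g"
          unfolding set_integrable_def using g by (intro integrable_mult_indicator) auto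
        moreover have "set_integrable lborel ?B (\<lambda>x. p)"
          unfolding set_integrable_def using fm[of i] by (intro integrable_scaleR_left integrable_real_indicator) (auto simp: fmeasurable_def)
        moreover have "(LINT t:?B|lborel. p) = p * (2 * snd i)"
          using len[OF i] by (simp add: set_lebesgue_integral_def)
        ultimately show "q * (2 * snd i) - p * (2 * snd i) \<le> (LINT t:?B|lborel. g t - p)"
          using K(3)[OF i] by (simp add: set_integral_diff)
      qed
      also have "\<dots> = (LINT t:?V|lborel. g t - p)"
        using K(2) U(3) by (intro set_integral_finite_Union[symmetric] F(1) dj gp) auto
      also have "\<dots> \<le> e'"
        using K(2) F(1) by (intro small) auto
      finally have "measure lborel ?V \<le> e"
        using pq by (simp add: e'_def mult.commute)
      moreover have "?V \<in> fmeasurable lborel" using F(1) fm by (intro fmeasurable.finite_UN) auto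
      ultimately have "emeasure lborel ?V \<le> ennreal e"
        by (simp add: emeasure_eq_measure2 ennreal_leI)
      then show "emeasure lborel (\<Union>F') \<le> ennreal e" unfolding F(3) .
    qed (use C(1) in auto)
    moreover have Wb: "?W \<in> sets borel" using C(1) by (intro sets.countable_UN'') auto
    ultimately have "?W \<in> lmeasurable" "measure lebesgue ?W \<le> e"
      using \<open>e > 0\<close> by (auto simp: fmeasurable_def measure_def enn2real_leI le_less_trans)
    then have W: "?W \<union> (S - ?W) \<in> lmeasurable" "measure lebesgue (?W \<union> (S - ?W)) \<le> e"
      using C(4) measure_Un_le[of ?W lebesgue "S - ?W"]
      by (auto simp: negligible_imp_measurable negligible_imp_measure0 fmeasurableD simp del: Un_Diff_cancel intro!: fmeasurable.Un)
    have "S \<subseteq> ?W \<union> (S - ?W)" by (simp only: Un_Diff_cancel Un_upper2)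
    with W show "\<exists>T. ?E \<inter> {-real n<..<real n} \<subseteq> T \<and> T \<in> lmeasurable \<and> measure lebesgue T \<le> e"
      unfolding S_def[symmetric] by (intro exI conjI)
  qed
  then have "negligible (\<Union>n::nat. ?E \<inter> {-real n<..<real n})" by (rule negligible_Union_nat)
  moreover have "?E \<subseteq> (\<Union>n::nat. ?E \<inter> {-real n<..<real n})"
  proof
    fix x assume "x \<in> ?E"
    moreover obtain n :: nat where "\<bar>x\<bar> < real n" using reals_Archimedean2 by blast
    then have "x \<in> {-real n<..<real n}" by auto
    ultimately show "x \<in> (\<Union>n::nat. ?E \<inter> {-real n<..<real n})" by blast
  qed
  ultimately show ?thesis by (rule negligible_subset)
qed

end

text \<open>Rational \<open>p < q\<close> give countably many exceptional sets. Off them the upper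
  derivates of \<open>f\<close> are at most \<open>g x\<close>; applying the same to
  \<open>- f\<close> and \<open>- g\<close> bounds the lower derivates.\<close>

lemma lebesgue_differentiation:
  fixes f g :: "real \<Rightarrow> real"
  assumes g: "integrable lborel g"
    and f: "\<And>x y. x \<le> y \<Longrightarrow> f y - f x = (LINT t:{x..y}|lborel. g t)"
  shows "AE x in lebesgue. (f has_real_derivative g x) (at x)"
proof -
  define E where "E F G p q = {x. G x < p \<and> (\<forall>d>0. \<exists>y. y \<noteq> x \<and> \<bar>y - x\<bar> < d \<and> q < (F y - F x) / (y - x))}"
    for F G :: "real \<Rightarrow> real" and p q :: real
  define Q where "Q = {(p, q) \<in> \<rat> \<times> \<rat>. p < (q :: real)}"
  define N where "N F G = (\<Union>(p, q)\<in>Q. E F G p q)" for F G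
  have Q: "countable Q" unfolding Q_def
    by (rule countable_subset[of _ "\<rat> \<times> \<rat>"]) (auto intro: countable_rat)
  have neg: "negligible (N F G)"
    if "integrable lborel G" "\<And>x y. x \<le> y \<Longrightarrow> F y - F x = (LINT t:{x..y}|lborel. G t)" for F G
    unfolding N_def
  proof (intro negligible_countable_Union countable_image Q)
    fix S assume "S \<in> (\<lambda>(p, q). E F G p q) ` Q"
    then show "negligible S"
      using negligible_steep_difference_quotients[OF that] by (auto simp: Q_def E_def)
  qed
  have upper: "\<exists>d>0. \<forall>y. y \<noteq> x \<longrightarrow> \<bar>y - x\<bar> < d \<longrightarrow> (F y - F x) / (y - x) < G x + e"
    if asm: "x \<notin> N F G" "e > 0" for F G x e
  proof -
    \<comment> \<open>With \<open>G x < p < q < G x + e\<close>, a point outside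
      \<open>E F G p q\<close> can only have quotients at most \<open>q\<close> nearby.\<close>
    obtain p where p: "p \<in> \<rat>" "G x < p" "p < G x + e"
      using Rats_dense_in_real[of "G x" "G x + e"] asm by auto
    obtain q where q: "q \<in> \<rat>" "p < q" "q < G x + e"
      using Rats_dense_in_real[of p "G x + e"] p by auto
    have "x \<notin> E F G p q" using asm(1) p q by (auto simp: N_def Q_def)
    then obtain d where "d > 0" "\<And>y. y \<noteq> x \<Longrightarrow> \<bar>y - x\<bar> < d \<Longrightarrow> (F y - F x) / (y - x) \<le> q"
      using p(2) unfolding E_def by force
    with q(3) show ?thesis by (intro exI[of _ d] conjI allI impI le_less_trans[OF _ q(3)])
  qed
  have "negligible (N f g)" by (rule neg[OF g f])
  moreover have "negligible (N (\<lambda>x. - f x) (\<lambda>x. - g x))"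
  proof (rule neg)
    show "integrable lborel (\<lambda>x. - g x)" using g by simp
    show "- f y - - f x = (LINT t:{x..y}|lborel. - g t)" if "x \<le> y" for x y
      using f[OF that] by (simp add: set_lebesgue_integral_def)
  qed
  ultimately have "negligible (N f g \<union> N (\<lambda>x. - f x) (\<lambda>x. - g x))"
    by (rule negligible_Un)
  then have "AE x in lebesgue. x \<notin> N f g \<union> N (\<lambda>x. - f x) (\<lambda>x. - g x)"
    unfolding negligible_iff_null_sets by (rule AE_not_in)
  then show ?thesis
  proof eventually_elim
    case (elim x)
    show ?case
      unfolding has_field_derivative_iff LIM_eq
    proof (intro allI impI)
      fix e :: real assume "e > 0"
      obtain d1 where d1: "d1 > 0" "\<forall>y. y \<noteq> x \<longrightarrow> \<bar>y - x\<bar> < d1 \<longrightarrow> (f y - f x) / (y - x) < g x + e"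
        using upper[of x f g e] elim \<open>e > 0\<close> by auto
      obtain d2 where d2: "d2 > 0" "\<forall>y. y \<noteq> x \<longrightarrow> \<bar>y - x\<bar> < d2 \<longrightarrow> (- f y - - f x) / (y - x) < - g x + e"
        using upper[of x "\<lambda>x. - f x" "\<lambda>x. - g x" e] elim \<open>e > 0\<close> by auto
      have "\<bar>(f y - f x) / (y - x) - g x\<bar> < e" if "y \<noteq> x" "\<bar>y - x\<bar> < min d1 d2" for y
      proof -
        have "- f y - - f x = - (f y - f x)" by simp
        then have "(- f y - - f x) / (y - x) = - ((f y - f x) / (y - x))"
          by (simp only: minus_divide_left)
        then have "- ((f y - f x) / (y - x)) < - g x + e" using d2(2) that by auto
        moreover have "(f y - f x) / (y - x) < g x + e" using d1(2) that by auto
        ultimately show ?thesis by (simp add: abs_less_iff)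
      qed
      then show "\<exists>s>0. \<forall>y. y \<noteq> x \<and> norm (y - x) < s \<longrightarrow> norm ((f y - f x) / (y - x) - g x) < e"
        using d1(1) d2(1) by (intro exI[of _ "min d1 d2"]) auto
    qed
  qed
qed

text \<open>Continue \<open>f\<close> constantly and its density by 0, so that the differentiation
  theorem on the line applies. The derivative is claimed in the open interval, where the
  continuation agrees with \<open>f\<close> near each point.\<close>

lemma abs_continuous_imp_indefinite_integral:
  assumes ab: "a \<le> b" and AC: "abs_continuous_on_interval a b f"
  obtains g where "integrable lborel g"
    "\<And>x y. a \<le> x \<Longrightarrow> x \<le> y \<Longrightarrow> y \<le> b \<Longrightarrow> f y - f x = (LINT t:{x..y}|lborel. g t)"
    "AE x in lebesgue. x \<in> {a<..<b} \<longrightarrow> (f has_real_derivative g x) (at x)"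
proof -
  obtain g where g: "integrable lborel g"
    "\<And>x y. a \<le> x \<Longrightarrow> x \<le> y \<Longrightarrow> y \<le> b \<Longrightarrow> f y - f x = (LINT t:{x..y}|lborel. g t)"
    using abs_continuous_density[OF assms] by metis
  define G where "G x = indicator {a..b} x *\<^sub>R g x" for x
  define F where "F x = f (max a (min b x))" for x
  have G: "integrable lborel G"
    unfolding G_def using g(1) by (intro integrable_mult_indicator) auto
  have FG: "F y - F x = (LINT t:{x..y}|lborel. G t)" if "x \<le> y" for x y
  proof -
    let ?x = "max a (min b x)" and ?y = "max a (min b y)"
    have "F y - F x = (LINT t:{?x..?y}|lborel. g t)"
      unfolding F_def using ab that by (intro g(2)) auto
    also have "\<dots> = (LINT t:{x..y}|lborel. G t)"
      unfolding set_lebesgue_integral_def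
    proof (rule integral_cong_AE)
      \<comment> \<open>An interval outside [a, b] is clamped to a single endpoint, so the two
        integrands can differ at \<open>a\<close> and \<open>b\<close> only.\<close>
      have "AE t in lborel. t \<noteq> a \<and> t \<noteq> b"
        by (intro AE_conjI AE_lborel_singleton)
      then show "AE t in lborel. indicat_real {?x..?y} t *\<^sub>R g t = indicat_real {x..y} t *\<^sub>R G t"
        by eventually_elim (use ab in \<open>auto simp: G_def indicator_def\<close>)
    qed (use g(1) G in measurable)
    finally show ?thesis .
  qed
  have "AE x in lebesgue. (F has_real_derivative G x) (at x)"
    by (rule lebesgue_differentiation[OF G]) (rule FG)
  then have "AE x in lebesgue. x \<in> {a<..<b} \<longrightarrow> (f has_real_derivative g x) (at x)"
  proof eventually_elim
    case (elim x)
    show ?case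
    proof
      assume x: "x \<in> {a<..<b}"
      then have "G x = g x" by (simp add: G_def)
      with elim have "(F has_real_derivative g x) (at x)" by simp
      then show "(f has_real_derivative g x) (at x)"
        by (rule has_field_derivative_transform_within_open[of _ _ _ "{a<..<b}"]) (use x in \<open>auto simp: F_def\<close>)
    qed
  qed
  with g that show thesis by blast
qed

section \<open>The explicit distance\<close>

text \<open>The median of \<open>0\<close>, \<open>a\<close> and \<open>b\<close>: the point of the
  line where the segments from 0 to \<open>a\<close> and to \<open>b\<close> part.\<close>

definition aligned_min :: "real \<Rightarrow> real \<Rightarrow> real" where
  "aligned_min a b = (if 0 \<le> a \<and> 0 \<le> b then min a b else if a \<le> 0 \<and> b \<le> 0 then max a b else 0)"

definition meet :: "real ^ 'n \<Rightarrow> real ^ 'n \<Rightarrow> real ^ 'n" where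
  "meet x y = (\<chi> i. aligned_min (x $ i) (y $ i))"

text \<open>In a rooted tree with \<open>artanh\<close> of the norm as height, this would be the
  distance of two vertices whose paths from the root part at \<open>meet x y\<close>.\<close>

definition tree_dist :: "real ^ 'n \<Rightarrow> real ^ 'n \<Rightarrow> real" where
  "tree_dist x y = artanh (taxicab_norm x) + artanh (taxicab_norm y) - 2 * artanh (taxicab_norm (meet x y))"

lemma aligned_min_commute: "aligned_min a b = aligned_min b a"
  by (auto simp: aligned_min_def)

lemma meet_commute: "meet x y = meet y x"
  by (simp add: meet_def aligned_min_commute)

lemma tree_dist_commute: "tree_dist x y = tree_dist y x"
  by (simp add: tree_dist_def meet_commute)

lemma abs_diff_aligned_min: "\<bar>a - b\<bar> = \<bar>a\<bar> + \<bar>b\<bar> - 2 * \<bar>aligned_min a b\<bar>"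
  by (auto simp: aligned_min_def min_def max_def)

lemma abs_aligned_min_le: "\<bar>aligned_min a b\<bar> \<le> \<bar>a\<bar>"
  by (auto simp: aligned_min_def min_def max_def)

text \<open>If both terms on the left are nonzero, all three numbers share a sign; then the larger
  term is at most \<open>\<bar>c\<bar>\<close> and the smaller at most
  \<open>\<bar>aligned_min a b\<bar>\<close>.\<close>

lemma abs_aligned_min_add_le:
  "\<bar>aligned_min a c\<bar> + \<bar>aligned_min b c\<bar> \<le> \<bar>c\<bar> + \<bar>aligned_min a b\<bar>"
  by (auto simp: aligned_min_def min_def max_def)

text \<open>Both points have the same sign, so the modulus is additive. This makes the norm affine
  on the segment from \<open>x\<close> to \<open>meet x y\<close>.\<close>

lemma abs_convex_aligned_min:
  assumes "0 \<le> s" "s \<le> 1"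
  shows "\<bar>(1 - s) * a + s * aligned_min a b\<bar> = (1 - s) * \<bar>a\<bar> + s * \<bar>aligned_min a b\<bar>"
proof -
  have "0 \<le> a \<and> 0 \<le> aligned_min a b \<or> a \<le> 0 \<and> aligned_min a b \<le> 0"
    by (auto simp: aligned_min_def)
  with assms show ?thesis
    by (auto simp: abs_mult abs_of_nonpos mult_nonneg_nonpos add_nonpos_nonpos)
qed

lemma taxicab_norm_nonneg: "0 \<le> taxicab_norm x"
  by (simp add: taxicab_norm_def sum_nonneg)

lemma taxicab_norm_diff: "taxicab_norm (x - y) = taxicab_norm x + taxicab_norm y - 2 * taxicab_norm (meet x y)"
  by (simp add: taxicab_norm_def meet_def abs_diff_aligned_min sum.distrib sum_subtractf sum_distrib_left)

lemma taxicab_norm_meet_le: "taxicab_norm (meet x y) \<le> taxicab_norm x" "taxicab_norm (meet x y) \<le> taxicab_norm y"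
  by (auto simp: taxicab_norm_def meet_def intro!: sum_mono abs_aligned_min_le)
     (subst aligned_min_commute, rule abs_aligned_min_le)

lemma taxicab_norm_meet_add_le:
  "taxicab_norm (meet x z) + taxicab_norm (meet y z) \<le> taxicab_norm z + taxicab_norm (meet x y)"
  by (simp add: taxicab_norm_def meet_def sum.distrib[symmetric] sum_mono abs_aligned_min_add_le)

lemma taxicab_norm_eq_0_iff: "taxicab_norm x = 0 \<longleftrightarrow> x = 0"
  by (auto simp: taxicab_norm_def sum_nonneg_eq_0_iff vec_eq_iff)

lemma taxicab_norm_convex_meet:
  assumes "0 \<le> s" "s \<le> 1"
  shows "taxicab_norm ((1 - s) *\<^sub>R x + s *\<^sub>R meet x y) = (1 - s) * taxicab_norm x + s * taxicab_norm (meet x y)"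
  using abs_convex_aligned_min[OF assms]
  by (simp add: taxicab_norm_def meet_def sum.distrib sum_distrib_left)

section \<open>Monotonicity and convexity of artanh\<close>

lemma artanh_mono:
  assumes "0 \<le> x" "x \<le> y" "y < (1::real)"
  shows "artanh x \<le> artanh y"
  unfolding artanh_def using assms by (intro divide_right_mono ln_mono frac_le) auto

lemma artanh_strict_mono:
  assumes "0 \<le> x" "x < y" "y < (1::real)"
  shows "artanh x < artanh y"
  unfolding artanh_def using assms by (auto simp: field_simps)

text \<open>Mean value theorem; the derivative is largest at the right endpoint.\<close>

lemma artanh_diff_le:
  assumes "0 \<le> x" "x \<le> y" "y < (1::real)"
  shows "artanh y - artanh x \<le> (y - x) / (1 - y\<^sup>2)"
proof (cases "x = y")
  case False
  then obtain z where z: "x < z" "z < y" "artanh y - artanh x = (y - x) * (1 / (1 - z\<^sup>2))"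
    using MVT2[of x y artanh "\<lambda>z. 1 / (1 - z\<^sup>2)"] assms
    by (force intro!: artanh_real_has_field_derivative)
  have "z\<^sup>2 \<le> y\<^sup>2" "y\<^sup>2 < 1" using z assms by (auto intro!: power_mono simp: abs_square_less_1)
  then have "1 / (1 - z\<^sup>2) \<le> 1 / (1 - y\<^sup>2)" by (intro divide_left_mono) auto
  then have "(y - x) * (1 / (1 - z\<^sup>2)) \<le> (y - x) * (1 / (1 - y\<^sup>2))"
    using assms(2) by (intro mult_left_mono) auto
  then show ?thesis using z(3) by simp
qed simp

text \<open>Convexity favours the extreme pair \<open>m\<close>, \<open>z\<close> over
  \<open>a\<close>, \<open>b\<close> at equal sums, and monotonicity allows \<open>a + b\<close> to
  be smaller. Taking exponentials makes it a polynomial inequality.\<close>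

lemma artanh_add_le:
  assumes "0 \<le> m" "m \<le> a" "a \<le> z" "m \<le> b" "b \<le> z" "z < (1::real)" "a + b \<le> z + m"
  shows "artanh a + artanh b \<le> artanh z + artanh m"
proof -
  let ?t = "m + z" and ?s = "a + b"
  \<comment> \<open>Twice this expression is the difference of the two sides of the cross-multiplied
    inequality that follows.\<close>
  have "0 \<le> (?t - ?s) * ((1 - a * z) + m * (z - a)) + ?t * ((a - m) * (z - a))"
    using assms mult_le_one[of a z] by (intro add_nonneg_nonneg mult_nonneg_nonneg) auto
  then have "(1 + a) * (1 + b) * ((1 - z) * (1 - m)) \<le> (1 + z) * (1 + m) * ((1 - a) * (1 - b))"
    by (simp add: algebra_simps)
  moreover have "N1 / D1 \<le> N2 / D2" if "0 < D1" "0 < D2" "N1 * D2 \<le> N2 * D1" for N1 N2 D1 D2 :: real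
    using that by (simp add: field_simps)
  ultimately have "(1 + a) * (1 + b) / ((1 - a) * (1 - b)) \<le> (1 + z) * (1 + m) / ((1 - z) * (1 - m))"
    using assms by simp
  then have "ln ((1 + a) * (1 + b) / ((1 - a) * (1 - b))) \<le> ln ((1 + z) * (1 + m) / ((1 - z) * (1 - m)))"
    using assms by (intro ln_mono) auto
  then show ?thesis
    using assms unfolding artanh_def add_divide_distrib[symmetric]
    by (intro divide_right_mono) (simp_all add: ln_mult ln_div)
qed


section \<open>The explicit distance as a metric\<close>

lemma tree_dist_triangle:
  assumes "x \<in> taxicab_ball" "y \<in> taxicab_ball" "z \<in> taxicab_ball"
  shows "tree_dist x y \<le> tree_dist x z + tree_dist z y"
proof -
  let ?a = "taxicab_norm (meet x z)" and ?b = "taxicab_norm (meet y z)" and ?m = "taxicab_norm (meet x y)"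
  have less: "taxicab_norm z < 1" "taxicab_norm x < 1" using assms by (auto simp: taxicab_ball_def)
  \<comment> \<open>The triangle inequality reduces to this once the terms of \<open>x\<close> and
    \<open>y\<close> alone cancel.\<close>
  have "artanh ?a + artanh ?b \<le> artanh (taxicab_norm z) + artanh ?m"
  proof -
    have le: "?a \<le> taxicab_norm z" "?b \<le> taxicab_norm z" "?a + ?b \<le> taxicab_norm z + ?m"
      using taxicab_norm_meet_le taxicab_norm_meet_add_le by auto
    \<comment> \<open>lowering \<open>?m\<close> to \<open>\<mu>\<close> secures \<open>\<mu> \<le> ?a, ?b\<close>, as the convexity lemma requires\<close>
    define \<mu> where "\<mu> = max 0 (?a + ?b - taxicab_norm z)"
    have \<mu>: "0 \<le> \<mu>" "\<mu> \<le> ?a" "\<mu> \<le> ?b" "\<mu> \<le> ?m" "?a + ?b \<le> taxicab_norm z + \<mu>"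
      using le taxicab_norm_nonneg[of "meet x z"] taxicab_norm_nonneg[of "meet y z"]
        taxicab_norm_nonneg[of "meet x y"] by (auto simp: \<mu>_def)
    have "artanh ?a + artanh ?b \<le> artanh (taxicab_norm z) + artanh \<mu>"
      using \<mu> le less by (intro artanh_add_le)
    also have "artanh \<mu> \<le> artanh ?m"
      using \<mu> less taxicab_norm_meet_le(1)[of x y] by (intro artanh_mono) auto
    finally show ?thesis by simp
  qed
  then show ?thesis by (simp add: tree_dist_def meet_commute[of z y])
qed

lemma tree_dist_nonneg:
  assumes "x \<in> taxicab_ball" "y \<in> taxicab_ball"
  shows "0 \<le> tree_dist x y"
proof -
  have "artanh (taxicab_norm (meet x y)) \<le> artanh (taxicab_norm x)"
    "artanh (taxicab_norm (meet x y)) \<le> artanh (taxicab_norm y)"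
    using assms by (auto intro!: artanh_mono taxicab_norm_nonneg taxicab_norm_meet_le simp: taxicab_ball_def)
  then show ?thesis by (simp add: tree_dist_def)
qed

text \<open>The distance is a sum of two nonnegative height differences. If both vanish, strict
  monotonicity of \<open>artanh\<close> equates the norms of \<open>x\<close>, \<open>y\<close> and
  \<open>meet x y\<close>, whence \<open>x - y\<close> has norm 0.\<close>

lemma tree_dist_eq_0_iff:
  assumes "x \<in> taxicab_ball" "y \<in> taxicab_ball"
  shows "tree_dist x y = 0 \<longleftrightarrow> x = y"
proof
  assume 0: "tree_dist x y = 0"
  have less: "taxicab_norm x < 1" "taxicab_norm y < 1" using assms by (auto simp: taxicab_ball_def)
  let ?m = "taxicab_norm (meet x y)"
  have le: "artanh ?m \<le> artanh (taxicab_norm x)" "artanh ?m \<le> artanh (taxicab_norm y)"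
    using less by (auto intro!: artanh_mono taxicab_norm_nonneg taxicab_norm_meet_le)
  have "?m = taxicab_norm x"
    using artanh_strict_mono[OF taxicab_norm_nonneg _ less(1), of "meet x y"] taxicab_norm_meet_le(1)[of x y] le 0
    by (force simp: tree_dist_def)
  moreover have "?m = taxicab_norm y"
    using artanh_strict_mono[OF taxicab_norm_nonneg _ less(2), of "meet x y"] taxicab_norm_meet_le(2)[of x y] le 0
    by (force simp: tree_dist_def)
  ultimately have "taxicab_norm (x - y) = 0" by (simp add: taxicab_norm_diff)
  then show "x = y" by (simp add: taxicab_norm_eq_0_iff)
next
  assume "x = y"
  moreover have "meet x x = x" by (auto simp: meet_def aligned_min_def vec_eq_iff)
  ultimately show "tree_dist x y = 0" by (simp add: tree_dist_def)
qed

text \<open>Bound the descent from either point to the meet by \<open>artanh_diff_le\<close>; the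
  two differences of norms add up to \<open>taxicab_norm (x - y)\<close>.\<close>

lemma tree_dist_le:
  assumes "taxicab_norm x \<le> r" "taxicab_norm y \<le> r" "r < 1"
  shows "tree_dist x y \<le> taxicab_norm (x - y) / (1 - r\<^sup>2)"
proof -
  let ?m = "taxicab_norm (meet x y)"
  have r2: "r\<^sup>2 < 1" using assms taxicab_norm_nonneg[of x] by (simp add: abs_square_less_1)
  have "artanh (taxicab_norm z) - artanh ?m \<le> (taxicab_norm z - ?m) / (1 - r\<^sup>2)"
    if "?m \<le> taxicab_norm z" "taxicab_norm z \<le> r" for z
  proof -
    have "artanh (taxicab_norm z) - artanh ?m \<le> (taxicab_norm z - ?m) / (1 - (taxicab_norm z)\<^sup>2)"
      using that assms by (intro artanh_diff_le taxicab_norm_nonneg) auto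
    also have "\<dots> \<le> (taxicab_norm z - ?m) / (1 - r\<^sup>2)"
    proof -
      have "(taxicab_norm z)\<^sup>2 \<le> r\<^sup>2" using that(2) by (intro power_mono taxicab_norm_nonneg)
      then show ?thesis using that r2 by (intro divide_left_mono mult_pos_pos) auto
    qed
    finally show ?thesis .
  qed
  from this[of x] this[of y] show ?thesis
    using assms taxicab_norm_meet_le[of x y]
    by (simp add: tree_dist_def taxicab_norm_diff diff_divide_distrib add_divide_distrib)
qed

section \<open>The four point condition with ln 3\<close>

lemma artanh_half_le:
  assumes "0 \<le> t" "t < (1::real)" "0 \<le> s" "s \<le> (1 + t) / 2"
  shows "artanh s \<le> artanh t + ln 3 / 2"
proof -
  have "artanh s \<le> artanh ((1 + t) / 2)" using assms by (intro artanh_mono) auto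
  also have "\<dots> = (ln (3 + t) - ln (1 - t)) / 2"
  proof -
    have "(1 + (1 + t) / 2) / (1 - (1 + t) / 2) = (3 + t) / (1 - t)" using assms by (simp add: field_simps)
    then show ?thesis using assms by (simp add: artanh_def ln_div)
  qed
  \<comment> \<open>The constant arises from \<open>3 + t \<le> 3 * (1 + t)\<close>, with equality
    at \<open>t = 0\<close>, where artanh(1/2) = ln 3 / 2.\<close>
  also have "\<dots> \<le> (ln (3 * (1 + t)) - ln (1 - t)) / 2"
    using assms by (intro divide_right_mono diff_right_mono ln_mono) auto
  also have "\<dots> = artanh t + ln 3 / 2"
  proof -
    have "ln (3 * (1 + t)) = ln 3 + ln (1 + t)" using assms by (subst ln_mult) auto
    then show ?thesis using assms by (simp add: artanh_def ln_div field_simps)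
  qed
  finally show ?thesis .
qed

lemma tree_dist_four_point:
  assumes "x \<in> taxicab_ball" "y \<in> taxicab_ball" "z \<in> taxicab_ball" "w \<in> taxicab_ball"
  shows "gromov_product tree_dist x y w
    \<ge> min (gromov_product tree_dist x z w) (gromov_product tree_dist y z w) - ln 3"
proof -
  define N where "N x y = taxicab_norm (meet x y)" for x y :: "real ^ 'a"
  have N0: "0 \<le> N x y" for x y by (simp add: N_def taxicab_norm_nonneg)
  have N1: "N u v < 1" if "u \<in> taxicab_ball" for u v
    using that taxicab_norm_meet_le(1)[of u v] by (simp add: N_def taxicab_ball_def)
  have sym: "N u v = N v u" for u v by (simp add: N_def meet_commute)
  have add: "N u v + N t v \<le> 1 + N u t" if "v \<in> taxicab_ball" for u v t
    using that taxicab_norm_meet_add_le[of u v t] by (simp add: N_def taxicab_ball_def)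
  \<comment> \<open>If \<open>N u v\<close> is the smaller summand in \<open>add\<close>, then
    \<open>2 * N u v \<le> 1 + N u t\<close>.\<close>
  have half: "artanh (N u v) \<le> artanh (N u t) + ln 3 / 2"
    if "u \<in> taxicab_ball" "v \<in> taxicab_ball" "N u v \<le> N t v" for u v t
    using add[OF that(2), of u t] that by (intro artanh_half_le N0 N1) auto
  \<comment> \<open>The heights of the single points cancel in the four point inequality; the
    minimum there becomes this disjunction.\<close>
  have "artanh (N x z) + artanh (N y w) \<le> artanh (N x y) + artanh (N z w) + ln 3 \<or>
      artanh (N y z) + artanh (N x w) \<le> artanh (N x y) + artanh (N z w) + ln 3"
  proof -
    \<comment> \<open>Cases by the largest mixed norm. It shares a point with each member of the
      other mixed pairing, so \<open>half\<close> bounds both of these.\<close>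
    consider "N x z \<le> N y z" "N y w \<le> N y z" | "N x z \<le> N x w" "N y w \<le> N x w"
      | "N y z \<le> N x z" "N x w \<le> N x z" | "N y z \<le> N y w" "N x w \<le> N y w"
      by linarith
    then show ?thesis
    proof cases
      case 1
      then show ?thesis
        using half[of x z y] half[of w y z] assms by (simp add: sym)
    next
      case 2
      then show ?thesis
        using half[of z x w] half[of y w x] assms by (simp add: sym)
    next
      case 3
      then show ?thesis
        using half[of y z x] half[of w x z] assms by (simp add: sym)
    next
      case 4
      then show ?thesis
        using half[of z y w] half[of x w y] assms by (simp add: sym)
    qed
  qed
  then show ?thesis
    by (auto simp: gromov_product_def tree_dist_def N_def min_def field_simps)
qed

section \<open>Lengths of curves\<close>

lemma abs_continuous_on_interval_lipschitz:
  assumes L: "0 \<le> L" and lip: "\<And>s t. \<bar>f t - f s\<bar> \<le> L * \<bar>t - s\<bar>"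
  shows "abs_continuous_on_interval a b f"
  unfolding abs_continuous_on_interval_def
proof (intro allI impI)
  fix \<epsilon> :: real assume \<epsilon>: "\<epsilon> > 0"
  have "(\<Sum>(u, v)\<in>D. \<bar>f v - f u\<bar>) < \<epsilon>"
    if D: "\<forall>(u, v)\<in>D. a \<le> u \<and> u \<le> v \<and> v \<le> b" and less: "(\<Sum>(u, v)\<in>D. v - u) < \<epsilon> / (L + 1)" for D
  proof -
    have "0 \<le> (\<Sum>(u, v)\<in>D. v - u)" using D by (intro sum_nonneg) auto
    have "(\<Sum>(u, v)\<in>D. \<bar>f v - f u\<bar>) \<le> (\<Sum>(u, v)\<in>D. L * (v - u))"
    proof (rule sum_mono)
      fix d assume "d \<in> D"
      then show "(case d of (u, v) \<Rightarrow> \<bar>f v - f u\<bar>) \<le> (case d of (u, v) \<Rightarrow> L * (v - u))"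
        using D lip[of "snd d" "fst d"] by (cases d) auto
    qed
    also have "\<dots> = L * (\<Sum>(u, v)\<in>D. v - u)" by (simp add: sum_distrib_left case_prod_unfold)
    also have "\<dots> \<le> (L + 1) * (\<Sum>(u, v)\<in>D. v - u)"
      using \<open>0 \<le> (\<Sum>(u, v)\<in>D. v - u)\<close> by (simp add: algebra_simps)
    also have "\<dots> < \<epsilon>" using less L by (simp add: pos_less_divide_eq mult.commute)
    finally show ?thesis .
  qed
  then show "\<exists>\<delta>>0. \<forall>D. finite D \<longrightarrow> (\<forall>(u, v)\<in>D. a \<le> u \<and> u \<le> v \<and> v \<le> b) \<longrightarrow>
      disjoint_family_on (\<lambda>(u, v). {u<..<v}) D \<longrightarrow> (\<Sum>(u, v)\<in>D. v - u) < \<delta> \<longrightarrow>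
      (\<Sum>(u, v)\<in>D. \<bar>f v - f u\<bar>) < \<epsilon>"
    using \<epsilon> L by (intro exI[of _ "\<epsilon> / (L + 1)"] conjI allI impI) auto
qed

abbreviation speed :: "(real \<Rightarrow> real ^ 'n) \<Rightarrow> real \<Rightarrow> real" where
  "speed \<gamma> t \<equiv> taxicab_norm (vector_derivative \<gamma> (at t within {0..1})) / (1 - (taxicab_norm (\<gamma> t))\<^sup>2)"

lemma taxicab_length_eq_integral:
  assumes "speed \<gamma> absolutely_integrable_on {0..1}"
  shows "taxicab_length \<gamma> = integral {0..1} (speed \<gamma>)"
  unfolding taxicab_length_def using set_lebesgue_integral_eq_integral(2)[OF assms] .

lemma one_minus_taxicab_norm_sq_pos:
  assumes "x \<in> taxicab_ball" shows "0 < 1 - (taxicab_norm x)\<^sup>2"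
  using assms taxicab_norm_nonneg[of x] by (simp add: taxicab_ball_def abs_square_less_1)

lemma has_vector_derivative_vec:
  fixes \<gamma> :: "real \<Rightarrow> real ^ 'n"
  assumes "\<And>i. ((\<lambda>t. \<gamma> t $ i) has_real_derivative v $ i) (at t within S)"
  shows "(\<gamma> has_vector_derivative v) (at t within S)"
  unfolding has_vector_derivative_def
proof (subst has_derivative_componentwise_within, intro ballI)
  fix b :: "real ^ 'n" assume "b \<in> Basis"
  then obtain i where "b = axis i 1" by (auto simp: Basis_vec_def)
  then show "((\<lambda>x. \<gamma> x \<bullet> b) has_derivative (\<lambda>x. (x *\<^sub>R v) \<bullet> b)) (at t within S)"
    using assms[of i] by (simp add: inner_axis has_field_derivative_def mult.commute[of _ "v $ i"])
qed

text \<open>On a short interval the conformal factor is almost constant, so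
  \<open>tree_dist_le\<close> bounds the distance by the length up to \<open>\<epsilon>\<close>;
  bisection with the triangle inequality extends this to [0, 1].\<close>

lemma tree_dist_le_taxicab_length:
  fixes \<gamma> :: "real \<Rightarrow> real ^ 'n"
  assumes \<gamma>: "\<gamma> \<in> taxicab_curves p q"
  shows "tree_dist p q \<le> taxicab_length \<gamma>"
proof -
  have ball: "\<gamma> t \<in> taxicab_ball" if "t \<in> {0..1}" for t
    using \<gamma> that unfolding taxicab_curves_def by blast
  have ends: "\<gamma> 0 = p" "\<gamma> 1 = q" using \<gamma> by (auto simp: taxicab_curves_def)
  have AC: "abs_continuous_on_interval 0 1 (\<lambda>t. \<gamma> t $ i)" for i
    using \<gamma> by (auto simp: taxicab_curves_def)
  let ?Q = "\<lambda>i g. integrable lborel g \<and>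
    (\<forall>x y. 0 \<le> x \<longrightarrow> x \<le> y \<longrightarrow> y \<le> 1 \<longrightarrow> \<gamma> y $ i - \<gamma> x $ i = (LINT t:{x..y}|lborel. g t)) \<and>
    (AE x in lebesgue. x \<in> {0<..<1} \<longrightarrow> ((\<lambda>t. \<gamma> t $ i) has_real_derivative g x) (at x))"
  have "\<exists>g. ?Q i g" for i
  proof (rule abs_continuous_imp_indefinite_integral[OF zero_le_one AC[of i]])
    fix g assume "integrable lborel g"
      "\<And>x y. 0 \<le> x \<Longrightarrow> x \<le> y \<Longrightarrow> y \<le> 1 \<Longrightarrow> \<gamma> y $ i - \<gamma> x $ i = (LINT t:{x..y}|lborel. g t)"
      "AE x in lebesgue. x \<in> {0<..<1} \<longrightarrow> ((\<lambda>t. \<gamma> t $ i) has_real_derivative g x) (at x)"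
    then show "\<exists>g. ?Q i g" by (intro exI[of _ g] conjI allI impI)
  qed
  then have "\<exists>g. \<forall>i. ?Q i (g i)" by (intro choice allI)
  then obtain g where "\<forall>i. ?Q i (g i)" by (elim exE)
  then have g: "\<And>i. integrable lborel (g i)"
    and inc: "\<And>i x y. 0 \<le> x \<Longrightarrow> x \<le> y \<Longrightarrow> y \<le> 1 \<Longrightarrow> \<gamma> y $ i - \<gamma> x $ i = (LINT t:{x..y}|lborel. g i t)"
    and der: "\<And>i. AE x in lebesgue. x \<in> {0<..<1} \<longrightarrow> ((\<lambda>t. \<gamma> t $ i) has_real_derivative g i x) (at x)"
    by simp_all
  \<comment> \<open>Almost everywhere \<open>h\<close> is the norm of the derivative;
    \<open>c\<close> is the conformal factor, continuous and hence bounded on [0, 1].\<close>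
  define h where "h t = (\<Sum>i\<in>UNIV. \<bar>g i t\<bar>)" for t
  define c where "c t = 1 / (1 - (taxicab_norm (\<gamma> t))\<^sup>2)" for t
  have h: "integrable lborel h" unfolding h_def using g by (intro Bochner_Integration.integrable_sum integrable_abs)
  have h0: "0 \<le> h t" for t by (simp add: h_def sum_nonneg)
  have pos: "0 < 1 - (taxicab_norm (\<gamma> t))\<^sup>2" if "t \<in> {0..1}" for t
    using one_minus_taxicab_norm_sq_pos[OF ball[OF that]] .
  have "continuous_on {0..1} (\<lambda>t. taxicab_norm (\<gamma> t))"
    unfolding taxicab_norm_def
    by (intro continuous_on_sum continuous_on_rabs abs_continuous_on_interval_imp_continuous_on AC)
  then have cont: "continuous_on {0..1} c"
    unfolding c_def
    by (intro continuous_on_divide continuous_on_diff continuous_on_power continuous_on_const)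
      (auto dest: pos)
  have cm: "(\<lambda>t. indicator {0..1} t *\<^sub>R c t) \<in> borel_measurable borel"
    using cont by (intro borel_measurable_continuous_on_indicator) auto
  obtain C where "\<forall>t\<in>{0..1}. \<bar>c t\<bar> \<le> C"
    using compact_imp_bounded[OF compact_continuous_image[OF cont compact_Icc]]
    by (auto simp: bounded_iff)
  then have C: "\<bar>c t\<bar> \<le> C" if "t \<in> {0..1}" for t using that by blast
  have "set_integrable lborel {0..1} (\<lambda>t. c t * h t)"
    unfolding set_integrable_def
  proof (rule Bochner_Integration.integrable_bound)
    show "integrable lborel (\<lambda>t. C * h t)" using h by simp
    have "(\<lambda>t. (indicat_real {0..1} t *\<^sub>R c t) * h t) \<in> borel_measurable lborel"
      using cm h by (intro borel_measurable_times) auto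
    then show "(\<lambda>t. indicat_real {0..1} t *\<^sub>R (c t * h t)) \<in> borel_measurable lborel"
      by (simp add: mult.assoc)
    show "AE t in lborel. norm (indicat_real {0..1} t *\<^sub>R (c t * h t)) \<le> norm (C * h t)"
    proof (rule AE_I2)
      fix t :: real
      have "0 \<le> C" using C[of 0] by simp
      then show "norm (indicat_real {0..1} t *\<^sub>R (c t * h t)) \<le> norm (C * h t)"
        using C[of t] h0[of t] by (auto simp: abs_mult indicator_def intro!: mult_right_mono)
    qed
  qed
  then have ai: "(\<lambda>t. c t * h t) absolutely_integrable_on {0..1}"
    unfolding set_integrable_def using borel_measurable_integrable integrable_completion by blast
  have "AE x in lebesgue. \<forall>i. x \<in> {0<..<1} \<longrightarrow> ((\<lambda>t. \<gamma> t $ i) has_real_derivative g i x) (at x)"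
    using der by (subst AE_all_countable) auto
  then obtain N' where N': "N' \<in> null_sets lebesgue"
    "{x \<in> space lebesgue. \<not> (\<forall>i. x \<in> {0<..<1} \<longrightarrow> ((\<lambda>t. \<gamma> t $ i) has_real_derivative g i x) (at x))} \<subseteq> N'"
    unfolding eventually_ae_filter by blast
  \<comment> \<open>The endpoints join the null set because the derivatives are known in the open
    interval only.\<close>
  define N where "N = N' \<union> {0, 1}"
  have N: "negligible N" unfolding N_def using N'(1)
    by (intro negligible_Un) (auto simp: negligible_iff_null_sets)
  have eq: "speed \<gamma> t = c t * h t" if t: "t \<in> {0..1} - N" for t
  proof -
    have "((\<lambda>t. \<gamma> t $ i) has_real_derivative g i t) (at t)" for i
      using t N'(2) by (auto simp: N_def less_le)
    then have "(\<gamma> has_vector_derivative (\<chi> i. g i t)) (at t within {0..1})"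
      using has_vector_derivative_vec[of \<gamma> "\<chi> i. g i t" t "{0..1}"]
      by (simp add: has_field_derivative_at_within)
    then have "vector_derivative \<gamma> (at t within {0..1}) = (\<chi> i. g i t)"
      by (rule vector_derivative_within_closed_interval[rotated 2]) (use t in auto)
    then show ?thesis by (simp add: c_def h_def taxicab_norm_def)
  qed
  have "speed \<gamma> absolutely_integrable_on {0..1}"
    by (rule absolutely_integrable_spike[OF ai N]) (use eq in auto)
  then have "taxicab_length \<gamma> = integral {0..1} (speed \<gamma>)" by (rule taxicab_length_eq_integral)
  also have "\<dots> = integral {0..1} (\<lambda>t. c t * h t)"
    by (rule integral_spike[OF N]) (use eq in auto)
  finally have len: "taxicab_length \<gamma> = integral {0..1} (\<lambda>t. c t * h t)" .
  have w_int: "(\<lambda>t. c t * h t) integrable_on {s..t}" if "0 \<le> s" "t \<le> 1" for s t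
    using set_lebesgue_integral_eq_integral(1)[OF ai] by (rule integrable_on_subinterval) (use that in auto)
  have hs: "set_integrable lborel {s..t} h" for s t
    unfolding set_integrable_def using h by (intro integrable_mult_indicator) auto
  have h_int: "h integrable_on {s..t}" and h_eq: "(LINT x:{s..t}|lborel. h x) = integral {s..t} h" for s t
    using set_borel_integral_eq_integral[OF hs] by auto
  have step: "taxicab_norm (\<gamma> t - \<gamma> s) \<le> integral {s..t} h" if "0 \<le> s" "s \<le> t" "t \<le> 1" for s t
  proof -
    have gi: "set_integrable lborel {s..t} (g i)" for i
      unfolding set_integrable_def using g by (intro integrable_mult_indicator) auto
    have "taxicab_norm (\<gamma> t - \<gamma> s) = (\<Sum>i\<in>UNIV. \<bar>LINT x:{s..t}|lborel. g i x\<bar>)"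
      using inc[OF that] by (simp add: taxicab_norm_def)
    also have "\<dots> \<le> (\<Sum>i\<in>UNIV. LINT x:{s..t}|lborel. \<bar>g i x\<bar>)"
      using set_integral_norm_bound[OF gi] by (intro sum_mono) simp
    also have "\<dots> = (LINT x:{s..t}|lborel. h x)"
      unfolding h_def set_lebesgue_integral_def scaleR_sum_right
      using set_integrable_abs[OF gi] by (subst Bochner_Integration.integral_sum) (auto simp: set_integrable_def)
    finally show ?thesis by (simp add: h_eq)
  qed
  have main: "tree_dist p q \<le> integral {0..1} (\<lambda>\<tau>. (c \<tau> + \<epsilon>) * h \<tau>)" if \<epsilon>: "\<epsilon> > 0" for \<epsilon>
  proof -
    have J: "(\<lambda>\<tau>. (c \<tau> + \<epsilon>) * h \<tau>) integrable_on {s..t}" if "0 \<le> s" "t \<le> 1" for s t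
      using integrable_add[OF w_int[OF that] integrable_on_mult_right[OF h_int, of \<epsilon> s t]]
      by (simp add: algebra_simps)
    \<comment> \<open>Adding \<open>\<epsilon>\<close> to \<open>c\<close> absorbs its oscillation
      on short intervals. The guards again handle intervals that leave [0, 1].\<close>
    define P where "P s t \<longleftrightarrow> (0 \<le> s \<longrightarrow> t \<le> 1 \<longrightarrow>
      tree_dist (\<gamma> s) (\<gamma> t) \<le> integral {s..t} (\<lambda>\<tau>. (c \<tau> + \<epsilon>) * h \<tau>))" for s t
    have "P 0 1"
    proof (rule Bolzano)
      fix s m t assume P: "P s m" "P m t" and le: "s \<le> m" "m \<le> t"
      show "P s t" unfolding P_def
      proof (intro impI)
        assume st: "0 \<le> s" "t \<le> 1"
        have "tree_dist (\<gamma> s) (\<gamma> t) \<le> tree_dist (\<gamma> s) (\<gamma> m) + tree_dist (\<gamma> m) (\<gamma> t)"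
          using st le by (intro tree_dist_triangle ball) auto
        also have "\<dots> \<le> integral {s..m} (\<lambda>\<tau>. (c \<tau> + \<epsilon>) * h \<tau>) + integral {m..t} (\<lambda>\<tau>. (c \<tau> + \<epsilon>) * h \<tau>)"
          using P st le by (intro add_mono) (auto simp: P_def)
        also have "\<dots> = integral {s..t} (\<lambda>\<tau>. (c \<tau> + \<epsilon>) * h \<tau>)"
          using le J[OF st] by (rule Henstock_Kurzweil_Integration.integral_combine)
        finally show "tree_dist (\<gamma> s) (\<gamma> t) \<le> integral {s..t} (\<lambda>\<tau>. (c \<tau> + \<epsilon>) * h \<tau>)" .
      qed
    next
      fix x :: real assume x: "0 \<le> x" "x \<le> 1"
      obtain d where d: "d > 0" "\<And>\<tau>. \<tau> \<in> {0..1} \<Longrightarrow> \<bar>\<tau> - x\<bar> < d \<Longrightarrow> \<bar>c \<tau> - c x\<bar> < \<epsilon> / 2"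
      proof -
        have "\<epsilon> / 2 > 0" "x \<in> {0..1}" using \<epsilon> x by auto
        with cont show thesis unfolding continuous_on_iff dist_real_def by (metis that)
      qed
      have "P s t" if st: "s \<le> x \<and> x \<le> t \<and> t - s < d" for s t
        unfolding P_def
      proof (intro impI)
        assume 01: "0 \<le> s" "t \<le> 1"
        \<comment> \<open>The endpoint of larger norm: its norm serves as the radius in
          \<open>tree_dist_le\<close>, so the factor is a value of \<open>c\<close> near
          \<open>x\<close>.\<close>
        define m where "m = (if taxicab_norm (\<gamma> s) \<le> taxicab_norm (\<gamma> t) then t else s)"
        have m: "m \<in> {s..t}" "taxicab_norm (\<gamma> s) \<le> taxicab_norm (\<gamma> m)" "taxicab_norm (\<gamma> t) \<le> taxicab_norm (\<gamma> m)"
          using st by (auto simp: m_def)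
        then have m01: "m \<in> {0..1}" using 01 by auto
        have "tree_dist (\<gamma> s) (\<gamma> t) = tree_dist (\<gamma> t) (\<gamma> s)" by (rule tree_dist_commute)
        also have "\<dots> \<le> taxicab_norm (\<gamma> t - \<gamma> s) / (1 - (taxicab_norm (\<gamma> m))\<^sup>2)"
          using m ball[OF m01] by (intro tree_dist_le) (auto simp: taxicab_ball_def)
        also have "\<dots> = c m * taxicab_norm (\<gamma> t - \<gamma> s)" by (simp add: c_def)
        also have "\<dots> \<le> c m * integral {s..t} h"
          using step[of s t] 01 st pos[OF m01] by (intro mult_left_mono) (auto simp: c_def)
        also have "\<dots> = integral {s..t} (\<lambda>\<tau>. c m * h \<tau>)" by simp
        also have "\<dots> \<le> integral {s..t} (\<lambda>\<tau>. (c \<tau> + \<epsilon>) * h \<tau>)"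
        proof (intro integral_le J 01 integrable_on_mult_right h_int mult_right_mono h0)
          fix \<tau> assume "\<tau> \<in> {s..t}"
          then have "\<bar>c \<tau> - c x\<bar> < \<epsilon> / 2" "\<bar>c m - c x\<bar> < \<epsilon> / 2"
            using st 01 m(1) d(2)[of \<tau>] d(2)[of m] by auto
          then show "c m \<le> c \<tau> + \<epsilon>" by linarith
        qed
        finally show "tree_dist (\<gamma> s) (\<gamma> t) \<le> integral {s..t} (\<lambda>\<tau>. (c \<tau> + \<epsilon>) * h \<tau>)" .
      qed
      then show "\<exists>d>0. \<forall>s t. s \<le> x \<and> x \<le> t \<and> t - s < d \<longrightarrow> P s t" using d(1) by blast
    qed simp
    then show ?thesis by (simp add: P_def ends)
  qed
  have "tree_dist p q \<le> integral {0..1} (\<lambda>t. c t * h t) + e" if "e > 0" for e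
  proof -
    let ?H = "integral {0..1} h"
    have H: "0 \<le> ?H" using h0 by (intro Henstock_Kurzweil_Integration.integral_nonneg h_int) auto
    \<comment> \<open>The added 1 covers the case that \<open>h\<close> has integral 0.\<close>
    define \<epsilon> where "\<epsilon> = e / (?H + 1)"
    have \<epsilon>: "\<epsilon> > 0" "\<epsilon> * ?H \<le> e" using that H by (auto simp: \<epsilon>_def field_simps)
    have "integral {0..1} (\<lambda>\<tau>. (c \<tau> + \<epsilon>) * h \<tau>) = integral {0..1} (\<lambda>t. c t * h t) + \<epsilon> * ?H"
      using Henstock_Kurzweil_Integration.integral_add[OF w_int[of 0 1] integrable_on_mult_right[OF h_int, of \<epsilon> 0 1]]
      by (simp add: algebra_simps)
    with main[OF \<epsilon>(1)] \<epsilon>(2) show ?thesis by simp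
  qed
  then show ?thesis unfolding len by (rule field_le_epsilon)
qed

section \<open>A shortest path through the meet\<close>

lemma artanh_affine_has_integral:
  assumes ab: "a \<le> b" and r: "\<And>t. t \<in> {a..b} \<Longrightarrow> \<bar>u + t * v\<bar> < (1::real)"
  shows "((\<lambda>t. v / (1 - (u + t * v)\<^sup>2)) has_integral (artanh (u + b * v) - artanh (u + a * v))) {a..b}"
proof (rule fundamental_theorem_of_calculus[OF ab])
  fix t assume t: "t \<in> {a..b}"
  have "((\<lambda>t. artanh (u + t * v)) has_real_derivative 1 / (1 - (u + t * v)\<^sup>2) * v) (at t within {a..b})"
    by (rule DERIV_chain2[where f = artanh and g = "\<lambda>t. u + t * v", OF artanh_real_has_field_derivative[OF r[OF t]]])
      (auto intro!: derivative_eq_intros)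
  then show "((\<lambda>t. artanh (u + t * v)) has_vector_derivative v / (1 - (u + t * v)\<^sup>2)) (at t within {a..b})"
    by (simp add: has_real_derivative_iff_has_vector_derivative)
qed

text \<open>Each clamped coefficient switches its leg off on one half of the time, so a single
  formula, visibly Lipschitz, reaches the meet at time 1/2.\<close>

definition meet_path :: "real ^ 'n \<Rightarrow> real ^ 'n \<Rightarrow> real \<Rightarrow> real ^ 'n" where
  "meet_path p q t = meet p q + max 0 (1 - 2 * t) *\<^sub>R (p - meet p q) + max 0 (2 * t - 1) *\<^sub>R (q - meet p q)"

lemma taxicab_norm_scaleR: "taxicab_norm (c *\<^sub>R x) = \<bar>c\<bar> * taxicab_norm x"
  by (simp add: taxicab_norm_def abs_mult sum_distrib_left)

lemma taxicab_norm_minus_meet: "taxicab_norm (x - meet x y) = taxicab_norm x - taxicab_norm (meet x y)"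
proof -
  have "meet x (meet x y) = meet x y"
    by (auto simp: meet_def aligned_min_def vec_eq_iff min_def max_def)
  then show ?thesis using taxicab_norm_diff[of x "meet x y"] by simp
qed

context
  fixes p q :: "real ^ 'n"
  assumes p: "p \<in> taxicab_ball" and q: "q \<in> taxicab_ball"
begin

text \<open>The norm is affine on both legs. The intercept and slope form suits
  \<open>artanh_affine_has_integral\<close>; the second intercept is the extrapolation to time
  0.\<close>

lemma taxicab_norm_meet_path:
  assumes "0 \<le> t" "t \<le> 1"
  shows "t \<le> 1/2 \<Longrightarrow> taxicab_norm (meet_path p q t) =
      taxicab_norm p + t * (- 2 * (taxicab_norm p - taxicab_norm (meet p q)))"
    and "1/2 \<le> t \<Longrightarrow> taxicab_norm (meet_path p q t) =
      2 * taxicab_norm (meet p q) - taxicab_norm q + t * (2 * (taxicab_norm q - taxicab_norm (meet p q)))"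
proof -
  assume t: "t \<le> 1/2"
  then have eq: "meet_path p q t = (1 - 2 * t) *\<^sub>R p + (2 * t) *\<^sub>R meet p q"
    by (simp add: meet_path_def max_def vec_eq_iff algebra_simps)
  then show "taxicab_norm (meet_path p q t) =
      taxicab_norm p + t * (- 2 * (taxicab_norm p - taxicab_norm (meet p q)))"
    unfolding eq by (subst taxicab_norm_convex_meet) (use assms t in \<open>auto simp: algebra_simps\<close>)
next
  assume t: "1/2 \<le> t"
  \<comment> \<open>The second leg read backwards is the first leg with \<open>p\<close> and
    \<open>q\<close> exchanged.\<close>
  then have eq: "meet_path p q t = (1 - (2 - 2 * t)) *\<^sub>R q + (2 - 2 * t) *\<^sub>R meet q p"
    by (simp add: meet_path_def max_def vec_eq_iff algebra_simps meet_commute[of q p])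
  then show "taxicab_norm (meet_path p q t) =
      2 * taxicab_norm (meet p q) - taxicab_norm q + t * (2 * (taxicab_norm q - taxicab_norm (meet p q)))"
    unfolding eq
    by (subst taxicab_norm_convex_meet) (use assms t in \<open>auto simp: algebra_simps meet_commute[of q p]\<close>)
qed

lemma meet_path_in_ball:
  assumes "0 \<le> t" "t \<le> 1"
  shows "meet_path p q t \<in> taxicab_ball"
proof (cases "t \<le> 1/2")
  case True
  then have "taxicab_norm (meet_path p q t) \<le> taxicab_norm p"
    using taxicab_norm_meet_path(1)[OF assms True] taxicab_norm_meet_le(1)[of p q] assms
    by (simp add: mult_nonneg_nonpos)
  then show ?thesis using p by (simp add: taxicab_ball_def)
next
  case False
  then have "taxicab_norm (meet_path p q t) = taxicab_norm q - (2 * (1 - t)) * (taxicab_norm q - taxicab_norm (meet p q))"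
    using taxicab_norm_meet_path(2)[OF assms] by (simp add: algebra_simps)
  also have "\<dots> \<le> taxicab_norm q"
    using taxicab_norm_meet_le(2)[of p q] assms by simp
  finally show ?thesis using q by (simp add: taxicab_ball_def)
qed

lemma meet_path_in_taxicab_curves: "meet_path p q \<in> taxicab_curves p q"
  unfolding taxicab_curves_def
proof (intro CollectI conjI allI)
  show "meet_path p q ` {0..1} \<subseteq> taxicab_ball" using meet_path_in_ball by auto
  show "meet_path p q 0 = p" "meet_path p q 1 = q" by (simp_all add: meet_path_def)
  fix i
  let ?u = "(p - meet p q) $ i" and ?v = "(q - meet p q) $ i"
  show "abs_continuous_on_interval 0 1 (\<lambda>t. meet_path p q t $ i)"
  proof (rule abs_continuous_on_interval_lipschitz)
    show "0 \<le> 2 * \<bar>?u\<bar> + 2 * \<bar>?v\<bar>" by simp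
    fix s t :: real
    have "meet_path p q t $ i - meet_path p q s $ i =
        (max 0 (1 - 2 * t) - max 0 (1 - 2 * s)) * ?u + (max 0 (2 * t - 1) - max 0 (2 * s - 1)) * ?v"
      by (simp add: meet_path_def algebra_simps)
    also have "\<bar>\<dots>\<bar> \<le> \<bar>max 0 (1 - 2 * t) - max 0 (1 - 2 * s)\<bar> * \<bar>?u\<bar> + \<bar>max 0 (2 * t - 1) - max 0 (2 * s - 1)\<bar> * \<bar>?v\<bar>"
      unfolding abs_mult[symmetric] by (rule abs_triangle_ineq)
    also have "\<dots> \<le> (2 * \<bar>t - s\<bar>) * \<bar>?u\<bar> + (2 * \<bar>t - s\<bar>) * \<bar>?v\<bar>"
      by (intro add_mono mult_right_mono) (auto simp: max_def abs_if)
    finally show "\<bar>meet_path p q t $ i - meet_path p q s $ i\<bar> \<le> (2 * \<bar>?u\<bar> + 2 * \<bar>?v\<bar>) * \<bar>t - s\<bar>"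
      by (simp add: algebra_simps)
  qed
qed

lemma taxicab_length_meet_path: "taxicab_length (meet_path p q) = tree_dist p q"
proof -
  let ?P = "taxicab_norm p" and ?Q = "taxicab_norm q" and ?M = "taxicab_norm (meet p q)"
  have M: "?M \<le> ?P" "?M \<le> ?Q" using taxicab_norm_meet_le by auto
  have norm_less: "\<bar>taxicab_norm (meet_path p q t)\<bar> < 1" if "0 \<le> t" "t \<le> 1" for t
    using meet_path_in_ball[OF that] taxicab_norm_nonneg[of "meet_path p q t"] by (simp add: taxicab_ball_def)
  have vd: "vector_derivative (meet_path p q) (at t within {0..1}) = w"
    if "open S" "t \<in> S" "t \<in> {0..1}" "\<And>s. s \<in> S \<Longrightarrow> meet_path p q s = z + s *\<^sub>R w" for t S z w
  proof -
    have "((\<lambda>s. z + s *\<^sub>R w) has_vector_derivative w) (at t)"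
      by (auto intro!: derivative_eq_intros)
    then have "(meet_path p q has_vector_derivative w) (at t)"
      by (rule has_vector_derivative_transform_within_open[OF _ that(1,2)]) (simp add: that(4))
    then show ?thesis
      by (rule vector_derivative_within_closed_interval[OF zero_less_one that(3) has_vector_derivative_at_within])
  qed
  have "((\<lambda>t. (- 2 * (?P - ?M)) / (1 - (?P + t * (- 2 * (?P - ?M)))\<^sup>2)) has_integral
      (artanh (?P + 1/2 * (- 2 * (?P - ?M))) - artanh (?P + 0 * (- 2 * (?P - ?M))))) {0..1/2}"
  proof (rule artanh_affine_has_integral)
    fix t :: real assume "t \<in> {0..1/2}"
    then show "\<bar>?P + t * (- 2 * (?P - ?M))\<bar> < 1"
      using taxicab_norm_meet_path(1)[of t] norm_less[of t] by auto
  qed simp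
  \<comment> \<open>The norm does not increase on this leg, so the speed is the negative of the
    integrand above.\<close>
  then have "((\<lambda>t. - ((- 2 * (?P - ?M)) / (1 - (?P + t * (- 2 * (?P - ?M)))\<^sup>2))) has_integral
      - (artanh (?P + 1/2 * (- 2 * (?P - ?M))) - artanh (?P + 0 * (- 2 * (?P - ?M))))) {0..1/2}"
    by (rule has_integral_neg)
  then have "(speed (meet_path p q) has_integral
      - (artanh (?P + 1/2 * (- 2 * (?P - ?M))) - artanh (?P + 0 * (- 2 * (?P - ?M))))) {0..1/2}"
  \<comment> \<open>The path may have a corner at time 1/2; this point is discarded.\<close>
  proof (rule has_integral_spike_finite[where S = "{1/2}", rotated 2])
    fix t :: real assume t: "t \<in> {0..1/2} - {1/2}"
    \<comment> \<open>The affine formula holds on the whole ray, so time 0 has a full neighbourhood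
      as well.\<close>
    have "vector_derivative (meet_path p q) (at t within {0..1}) = (- 2) *\<^sub>R (p - meet p q)"
      by (rule vd[where S = "{..<1/2}" and z = p]) (use t in \<open>auto simp: meet_path_def max_def vec_eq_iff algebra_simps\<close>)
    moreover have "taxicab_norm ((- 2) *\<^sub>R (p - meet p q)) = 2 * (?P - ?M)"
      unfolding taxicab_norm_scaleR taxicab_norm_minus_meet by simp
    moreover have "taxicab_norm (meet_path p q t) = ?P + t * (- 2 * (?P - ?M))"
      using t by (intro taxicab_norm_meet_path(1)) auto
    ultimately have "speed (meet_path p q) t = 2 * (?P - ?M) / (1 - (?P + t * (- 2 * (?P - ?M)))\<^sup>2)"
      by (simp only:)
    then show "speed (meet_path p q) t = - ((- 2 * (?P - ?M)) / (1 - (?P + t * (- 2 * (?P - ?M)))\<^sup>2))"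
      by (simp only: minus_divide_left)
  qed simp
  moreover have "?P + 1/2 * (- 2 * (?P - ?M)) = ?M" "?P + 0 * (- 2 * (?P - ?M)) = ?P"
    by (simp_all add: field_simps)
  ultimately have 1: "(speed (meet_path p q) has_integral (artanh ?P - artanh ?M)) {0..1/2}"
    by (simp only: minus_diff_eq)
  have "((\<lambda>t. (2 * (?Q - ?M)) / (1 - (2 * ?M - ?Q + t * (2 * (?Q - ?M)))\<^sup>2)) has_integral
      (artanh (2 * ?M - ?Q + 1 * (2 * (?Q - ?M))) - artanh (2 * ?M - ?Q + 1/2 * (2 * (?Q - ?M))))) {1/2..1}"
  proof (rule artanh_affine_has_integral)
    fix t :: real assume "t \<in> {1/2..1}"
    then show "\<bar>2 * ?M - ?Q + t * (2 * (?Q - ?M))\<bar> < 1"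
      using taxicab_norm_meet_path(2)[of t] norm_less[of t] by auto
  qed simp
  then have "(speed (meet_path p q) has_integral
      (artanh (2 * ?M - ?Q + 1 * (2 * (?Q - ?M))) - artanh (2 * ?M - ?Q + 1/2 * (2 * (?Q - ?M))))) {1/2..1}"
  proof (rule has_integral_spike_finite[where S = "{1/2}", rotated 2])
    fix t :: real assume t: "t \<in> {1/2..1} - {1/2}"
    have "vector_derivative (meet_path p q) (at t within {0..1}) = 2 *\<^sub>R (q - meet p q)"
      by (rule vd[where S = "{1/2<..}" and z = "2 *\<^sub>R meet p q - q"])
        (use t in \<open>auto simp: meet_path_def max_def vec_eq_iff algebra_simps\<close>)
    moreover have "taxicab_norm (2 *\<^sub>R (q - meet p q)) = 2 * (?Q - ?M)"
      unfolding taxicab_norm_scaleR meet_commute[of p q] taxicab_norm_minus_meet by simp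
    moreover have "taxicab_norm (meet_path p q t) = 2 * ?M - ?Q + t * (2 * (?Q - ?M))"
      using t by (intro taxicab_norm_meet_path(2)) auto
    ultimately show "speed (meet_path p q) t = (2 * (?Q - ?M)) / (1 - (2 * ?M - ?Q + t * (2 * (?Q - ?M)))\<^sup>2)"
      by (simp only:)
  qed simp
  moreover have "2 * ?M - ?Q + 1 * (2 * (?Q - ?M)) = ?Q" "2 * ?M - ?Q + 1/2 * (2 * (?Q - ?M)) = ?M"
    by (simp_all add: field_simps)
  ultimately have 2: "(speed (meet_path p q) has_integral (artanh ?Q - artanh ?M)) {1/2..1}"
    by (simp only:)
  have hi: "(speed (meet_path p q) has_integral tree_dist p q) {0..1}"
    using has_integral_combine[OF _ _ 1 2] by (simp add: tree_dist_def algebra_simps)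
  \<comment> \<open>Nonnegativity turns the Henstock-Kurzweil integral into the Lebesgue integral
    that defines the length.\<close>
  have "speed (meet_path p q) absolutely_integrable_on {0..1}"
  proof (rule nonnegative_absolutely_integrable_1)
    fix t :: real assume "t \<in> {0..1}"
    then show "0 \<le> speed (meet_path p q) t"
      using one_minus_taxicab_norm_sq_pos[OF meet_path_in_ball] by (auto intro!: divide_nonneg_pos taxicab_norm_nonneg)
  qed (use hi in blast)
  from taxicab_length_eq_integral[OF this] show ?thesis using hi by (simp add: integral_unique)
qed

lemma taxicab_dist_eq_tree_dist: "taxicab_dist p q = tree_dist p q"
proof -
  have "(INF \<gamma>\<in>taxicab_curves p q. taxicab_length \<gamma>) = tree_dist p q"
  proof (rule antisym)
    have "(INF \<gamma>\<in>taxicab_curves p q. taxicab_length \<gamma>) \<le> taxicab_length (meet_path p q)"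
      by (intro cINF_lower meet_path_in_taxicab_curves bdd_belowI2[of _ "tree_dist p q"] tree_dist_le_taxicab_length)
    then show "(INF \<gamma>\<in>taxicab_curves p q. taxicab_length \<gamma>) \<le> tree_dist p q"
      by (simp add: taxicab_length_meet_path)
    show "tree_dist p q \<le> (INF \<gamma>\<in>taxicab_curves p q. taxicab_length \<gamma>)"
      using meet_path_in_taxicab_curves by (intro cINF_greatest tree_dist_le_taxicab_length) auto
  qed
  with p q show ?thesis by (simp add: taxicab_dist_def)
qed

end

section \<open>Hyperbolicity and the sharp constant\<close>

lemma Metric_space_taxicab_dist: "Metric_space (taxicab_ball :: (real ^ 'n) set) taxicab_dist"
proof
  fix x y :: "real ^ 'n"
  \<comment> \<open>Nonnegativity and symmetry are demanded of all vectors; if one lies off the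
    ball, the default value 0 settles both.\<close>
  show "0 \<le> taxicab_dist x y"
  proof (cases "x \<in> taxicab_ball \<and> y \<in> taxicab_ball")
    case True
    then show ?thesis by (simp add: taxicab_dist_eq_tree_dist tree_dist_nonneg)
  next
    case False
    then show ?thesis unfolding taxicab_dist_def by (simp only: if_False order_refl)
  qed
  show "taxicab_dist x y = taxicab_dist y x"
  proof (cases "x \<in> taxicab_ball \<and> y \<in> taxicab_ball")
    case True
    then show ?thesis using tree_dist_commute[of x y] by (simp only: taxicab_dist_eq_tree_dist)
  next
    case False
    then have "\<not> (y \<in> taxicab_ball \<and> x \<in> taxicab_ball)" by blast
    with False show ?thesis unfolding taxicab_dist_def by (simp only: if_False)
  qed
next
  fix x y z :: "real ^ 'n"
  assume "x \<in> taxicab_ball" "y \<in> taxicab_ball"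
  then show "taxicab_dist x y = 0 \<longleftrightarrow> x = y"
    by (simp add: taxicab_dist_eq_tree_dist tree_dist_eq_0_iff)
  assume "z \<in> taxicab_ball"
  then show "taxicab_dist x z \<le> taxicab_dist x y + taxicab_dist y z"
    using \<open>x \<in> taxicab_ball\<close> \<open>y \<in> taxicab_ball\<close>
    by (simp add: taxicab_dist_eq_tree_dist tree_dist_triangle)
qed

lemma gromov_hyperbolic_taxicab_iff:
  "gromov_hyperbolic \<delta> (taxicab_ball :: (real ^ 'n) set) taxicab_dist \<longleftrightarrow>
    0 \<le> \<delta> \<and> (\<forall>x\<in>taxicab_ball. \<forall>y\<in>taxicab_ball. \<forall>z\<in>taxicab_ball. \<forall>w\<in>(taxicab_ball :: (real ^ 'n) set).
      gromov_product tree_dist x y w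
        \<ge> min (gromov_product tree_dist x z w) (gromov_product tree_dist y z w) - \<delta>)"
proof -
  have eq: "gromov_product taxicab_dist x y w = gromov_product tree_dist x y w"
    if "x \<in> taxicab_ball" "y \<in> taxicab_ball" "w \<in> taxicab_ball" for x y w :: "real ^ 'n"
    using that by (simp add: gromov_product_def taxicab_dist_eq_tree_dist)
  show ?thesis
    unfolding gromov_hyperbolic_def
    by (simp only: Metric_space_taxicab_dist eq simp_thms cong: ball_cong)
qed

theorem theorem4:
  assumes "CARD('n::finite) \<ge> 2"
  shows "gromov_hyperbolic (ln 3) (taxicab_ball :: (real ^ 'n) set) taxicab_dist \<and>
    (\<forall>\<delta>\<ge>0. gromov_hyperbolic \<delta> (taxicab_ball :: (real ^ 'n) set) taxicab_dist \<longrightarrow> ln 3 \<le> \<delta>)"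
proof (intro conjI allI impI)
  show "gromov_hyperbolic (ln 3) (taxicab_ball :: (real ^ 'n) set) taxicab_dist"
    unfolding gromov_hyperbolic_taxicab_iff using tree_dist_four_point by auto
next
  fix \<delta> :: real
  assume "0 \<le> \<delta>" and hyp: "gromov_hyperbolic \<delta> (taxicab_ball :: (real ^ 'n) set) taxicab_dist"
  obtain i j :: 'n where ij: "i \<noteq> j"
  proof -
    have "\<exists>i j :: 'n. i \<noteq> j"
    proof (rule ccontr)
      assume "\<not> (\<exists>i j :: 'n. i \<noteq> j)"
      then have "(UNIV :: 'n set) = {undefined}" by auto
      then have "CARD('n) = card {undefined :: 'n}" by (rule arg_cong)
      with assms show False by simp
    qed
    then show thesis using that by blast
  qed
  define pt :: "real \<Rightarrow> real \<Rightarrow> real ^ 'n"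
    where "pt s t = (\<chi> k. if k = i then s else if k = j then t else 0)" for s t
  have norm_pt: "taxicab_norm (pt s t) = \<bar>s\<bar> + \<bar>t\<bar>" for s t
  proof -
    have "taxicab_norm (pt s t) = (\<Sum>k\<in>{i, j}. \<bar>pt s t $ k\<bar>)"
      unfolding taxicab_norm_def by (intro sum.mono_neutral_right) (auto simp: pt_def)
    then show ?thesis using ij by (simp add: pt_def)
  qed
  have meet_pt: "meet (pt s t) (pt s' t') = pt (aligned_min s s') (aligned_min t t')" for s t s' t'
  proof -
    have "aligned_min 0 0 = 0" by (simp add: aligned_min_def)
    then show ?thesis by (simp add: meet_def pt_def vec_eq_iff)
  qed
  \<comment> \<open>Corners of a square: opposite corners have meet 0, adjacent ones a meet of norm
    \<open>a\<close>. Both mixed sums are thus \<open>2 * artanh a\<close>, while the sum for the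
    opposite pairs is 0.\<close>
  have bound: "2 * artanh a \<le> \<delta>" if a: "0 \<le> a" "a < 1/2" for a
  proof -
    have "pt a a \<in> taxicab_ball" "pt (- a) (- a) \<in> taxicab_ball" "pt a (- a) \<in> taxicab_ball" "pt (- a) a \<in> taxicab_ball"
      using a by (auto simp: taxicab_ball_def norm_pt)
    then have "min (gromov_product tree_dist (pt a a) (pt a (- a)) (pt (- a) a))
        (gromov_product tree_dist (pt (- a) (- a)) (pt a (- a)) (pt (- a) a)) - \<delta>
        \<le> gromov_product tree_dist (pt a a) (pt (- a) (- a)) (pt (- a) a)"
      using hyp unfolding gromov_hyperbolic_taxicab_iff by blast
    moreover have "aligned_min a a = a" "aligned_min (- a) (- a) = - a" "aligned_min a (- a) = 0" "aligned_min (- a) a = 0"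
      using a by (auto simp: aligned_min_def)
    ultimately show ?thesis
      using a by (simp add: gromov_product_def tree_dist_def meet_pt norm_pt)
  qed
  show "ln 3 \<le> \<delta>"
  proof (rule ccontr)
    assume "\<not> ln 3 \<le> \<delta>"
    then have "exp \<delta> < 3" by (metis exp_less_cancel_iff exp_ln not_le zero_less_numeral)
    then obtain e where e: "exp \<delta> < e" "e < 3" using dense by blast
    have "1 \<le> exp \<delta>" using \<open>0 \<le> \<delta>\<close> by simp
    with e have "1 < e" by linarith
    \<comment> \<open>This number is tanh(ln e / 2), chosen so that doubling its artanh gives
      \<open>ln e\<close>; it is below 1/2 exactly when \<open>e < 3\<close>.\<close>
    with e have "0 \<le> (e - 1) / (e + 1)" "(e - 1) / (e + 1) < 1/2" by (auto simp: field_simps)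
    from bound[OF this] have "2 * artanh ((e - 1) / (e + 1)) \<le> \<delta>" .
    also have "2 * artanh ((e - 1) / (e + 1)) = ln e"
    proof -
      have "(1 + (e - 1) / (e + 1)) / (1 - (e - 1) / (e + 1)) = e"
        using \<open>1 < e\<close> by (simp add: field_simps)
      then show ?thesis by (simp add: artanh_def)
    qed
    finally have "e \<le> exp \<delta>"
      using \<open>1 < e\<close> exp_le_cancel_iff[of "ln e" \<delta>] by simp
    with e show False by simp
  qed
qed

end
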